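(* Let $A$ be a closed linear operator on a complex Banach lattice $E$ and suppose that $\lambda_0\in\sigma(A)\cap\mathbb{R}$ is a simple pole of $R(\cdot,A)$. Then the following are equivalent: (i) The spectral projection $P$ associated with $\lambda_0$ is positive. (ii) The resolvent $R(\cdot,A)$ is individually asymptotically positive at $\lambda_0$. (iii) The resolvent $R(\cdot,A)$ is uniformly asymptotically positive of bounded type at $\lambda_0$. If $\lambda_0=s(A)$, then (i)--(iii) are also equivalent to: (iv) There is $\lambda>s(A)$ such that the operator $R(\lambda,A)$ is individually asymptotically positive. (v) For each $\lambda>s(A)$ the operator $R(\lambda,A)$ is uniformly asymptotically positive.
   Context: $E_+$ is the positive cone of $E$ and $d_+(f):=\operatorname{dist}(f,E_+)$. $s(A)$ is the spectral bound; $P$ is the residue of $R(\cdot,A)$ at $\lambda_0$. Let $\lambda_0\in\mathbb{R}$ be a spectral value with $(\lambda_0,\lambda_0+\varepsilon]\subseteq\rho(A)$ for some $\varepsilon>0$ and $\limsup_{\lambda\downarrow\lambda_0}\|(\lambda-\lambda_0)R(\lambda,A)\|<\infty$. Then $R(\cdot,A)$ is individually asymptotically positive at $\lambda_0$ if $(\lambda-\lambda_0)d_+(R(\lambda,A)f)\to0$ as $\lambda\downarrow\lambda_0$ for each $f\in E_+$; and uniformly asymptotically positive of bounded type at $\lambda_0$ if there are $\lambda_1>\lambda_0$ and $K\ge0$ with $(\lambda_0,\lambda_1]\subseteq\rho(A)$ and $d_+(R(\lambda,A)f)\le K\|f\|$ for all $f\in E_+$, $\lambda\in(\lambda_0,\lambda_1]$.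 For a bounded operator $T$ with spectral radius $r(T)>0$ such that $T/r(T)$ is power bounded: $T$ is individually asymptotically positive if $d_+((T/r(T))^nf)\to0$ as $n\to\infty$ for every $f\in E_+$; uniformly asymptotically positive if for each $\varepsilon>0$ there is $n_0$ with $d_+((T/r(T))^nf)\le\varepsilon\|f\|$ for all $n\ge n_0$, $f\in E_+$ (these notions include the requirements $r(T)>0$ and $T/r(T)$ power bounded). *)

theory Defs
  imports "HOL-Analysis.Analysis"
begin

definition labs :: "'r::{ordered_real_vector,lattice} \<Rightarrow> 'r" where
  "labs x = sup x (- x)"

definition real_banach_lattice :: "'r::{banach,ordered_real_vector,lattice} itself \<Rightarrow> bool" where
  "real_banach_lattice _ \<longleftrightarrow> (\<forall>x y::'r. labs x \<le> labs y \<longrightarrow> norm x \<le> norm y)"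

section \<open>The complex Banach lattice: complexification E = E_R + i E_R, elements (x,y) = x + i y\<close>

definition csc :: "complex \<Rightarrow> ('r::real_vector \<times> 'r) \<Rightarrow> 'r \<times> 'r" where
  "csc c z = (Re c *\<^sub>R fst z - Im c *\<^sub>R snd z, Re c *\<^sub>R snd z + Im c *\<^sub>R fst z)"

text \<open>Norm of the complexification: the norm of the modulus
  |x + i y| = sup over theta of |cos theta x + sin theta y|; written as the infimum of
  the norms of all upper bounds (equal to the norm of the supremum by monotonicity of the norm).\<close>
definition cnorm :: "('r::{banach,ordered_real_vector,lattice} \<times> 'r) \<Rightarrow> real" where
  "cnorm z = Inf {norm u | u. \<forall>\<theta>::real. labs (cos \<theta> *\<^sub>R fst z + sin \<theta> *\<^sub>R snd z) \<le> u}"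

definition pos_cone :: "('r::{ordered_real_vector,lattice} \<times> 'r) set" where
  "pos_cone = {(x, 0) | x. 0 \<le> x}"

definition dplus :: "('r::{banach,ordered_real_vector,lattice} \<times> 'r) \<Rightarrow> real" where
  "dplus f = Inf {cnorm (f - g) | g. g \<in> pos_cone}"

definition csubspace :: "('r::real_vector \<times> 'r) set \<Rightarrow> bool" where
  "csubspace D \<longleftrightarrow> 0 \<in> D \<and> (\<forall>x\<in>D. \<forall>y\<in>D. x + y \<in> D) \<and> (\<forall>c. \<forall>x\<in>D. csc c x \<in> D)"

definition clinear_on :: "('r::real_vector \<times> 'r) set \<Rightarrow> ('r \<times> 'r \<Rightarrow> 'r \<times> 'r) \<Rightarrow> bool" where
  "clinear_on D A \<longleftrightarrow> csubspace D \<and> (\<forall>x\<in>D. \<forall>y\<in>D. A (x + y) = A x + A y)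
     \<and> (\<forall>c. \<forall>x\<in>D. A (csc c x) = csc c (A x))"

definition cconv :: "(nat \<Rightarrow> ('r::{banach,ordered_real_vector,lattice} \<times> 'r)) \<Rightarrow> 'r \<times> 'r \<Rightarrow> bool" where
  "cconv s l \<longleftrightarrow> (\<lambda>n. cnorm (s n - l)) \<longlonglongrightarrow> 0"

definition closed_operator :: "('r::{banach,ordered_real_vector,lattice} \<times> 'r) set \<Rightarrow> ('r \<times> 'r \<Rightarrow> 'r \<times> 'r) \<Rightarrow> bool" where
  "closed_operator D A \<longleftrightarrow> clinear_on D A \<and>
     (\<forall>s x y. (\<forall>n. s n \<in> D) \<and> cconv s x \<and> cconv (\<lambda>n. A (s n)) y \<longrightarrow> x \<in> D \<and> A x = y)"

definition cbounded :: "('r::{banach,ordered_real_vector,lattice} \<times> 'r \<Rightarrow> 'r \<times> 'r) \<Rightarrow> bool" where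
  "cbounded T \<longleftrightarrow> (\<exists>K. \<forall>x. cnorm (T x) \<le> K * cnorm x)"

definition resolvent :: "('r::real_vector \<times> 'r) set \<Rightarrow> ('r \<times> 'r \<Rightarrow> 'r \<times> 'r) \<Rightarrow> complex \<Rightarrow> 'r \<times> 'r \<Rightarrow> 'r \<times> 'r" where
  "resolvent D A l = (\<lambda>x. THE y. y \<in> D \<and> csc l y - A y = x)"

definition resolvent_set :: "('r::{banach,ordered_real_vector,lattice} \<times> 'r) set \<Rightarrow> ('r \<times> 'r \<Rightarrow> 'r \<times> 'r) \<Rightarrow> complex set" where
  "resolvent_set D A = {l. (\<forall>x. \<exists>!y. y \<in> D \<and> csc l y - A y = x) \<and> cbounded (resolvent D A l)}"

definition spectrum :: "('r::{banach,ordered_real_vector,lattice} \<times> 'r) set \<Rightarrow> ('r \<times> 'r \<Rightarrow> 'r \<times> 'r) \<Rightarrow> complex set" where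
  "spectrum D A = - resolvent_set D A"

definition spectral_bound :: "('r::{banach,ordered_real_vector,lattice} \<times> 'r) set \<Rightarrow> ('r \<times> 'r \<Rightarrow> 'r \<times> 'r) \<Rightarrow> ereal" where
  "spectral_bound D A = Sup ((\<lambda>z. ereal (Re z)) ` spectrum D A)"

definition residue_limit :: "('r::{banach,ordered_real_vector,lattice} \<times> 'r) set \<Rightarrow> ('r \<times> 'r \<Rightarrow> 'r \<times> 'r) \<Rightarrow> complex \<Rightarrow> ('r \<times> 'r \<Rightarrow> 'r \<times> 'r) \<Rightarrow> bool" where
  "residue_limit D A l0 P \<longleftrightarrow> (\<forall>\<epsilon>>0. \<forall>\<^sub>F l in at l0.
      \<forall>x. cnorm (csc (l - l0) (resolvent D A l x) - P x) \<le> \<epsilon> * cnorm x)"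

text \<open>l0 is a simple pole of the resolvent: l0 is an isolated spectral value and the
  resolvent has a pole of order one there, i.e. (l - l0) R(l,A) converges in operator norm
  to a bounded operator (the residue).\<close>
definition simple_pole :: "('r::{banach,ordered_real_vector,lattice} \<times> 'r) set \<Rightarrow> ('r \<times> 'r \<Rightarrow> 'r \<times> 'r) \<Rightarrow> complex \<Rightarrow> bool" where
  "simple_pole D A l0 \<longleftrightarrow> l0 \<in> spectrum D A \<and>
     (\<exists>r>0. ball l0 r - {l0} \<subseteq> resolvent_set D A) \<and>
     (\<exists>P. cbounded P \<and> residue_limit D A l0 P)"

text \<open>The residue (= spectral projection at a simple pole).\<close>
definition residue_op :: "('r::{banach,ordered_real_vector,lattice} \<times> 'r) set \<Rightarrow> ('r \<times> 'r \<Rightarrow> 'r \<times> 'r) \<Rightarrow> complex \<Rightarrow> 'r \<times> 'r \<Rightarrow> 'r \<times> 'r" where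
  "residue_op D A l0 = (THE P. residue_limit D A l0 P)"

definition positive_op :: "('r::{ordered_real_vector,lattice} \<times> 'r \<Rightarrow> 'r \<times> 'r) \<Rightarrow> bool" where
  "positive_op T \<longleftrightarrow> (\<forall>f\<in>pos_cone. T f \<in> pos_cone)"

definition resolvent_admissible :: "('r::{banach,ordered_real_vector,lattice} \<times> 'r) set \<Rightarrow> ('r \<times> 'r \<Rightarrow> 'r \<times> 'r) \<Rightarrow> real \<Rightarrow> bool" where
  "resolvent_admissible D A l0 \<longleftrightarrow>
     (\<exists>\<epsilon>>0. \<forall>l\<in>{l0<..l0+\<epsilon>}. complex_of_real l \<in> resolvent_set D A) \<and>
     (\<exists>M. \<forall>\<^sub>F l in at_right l0. \<forall>x.
        cnorm (csc (complex_of_real (l - l0)) (resolvent D A (complex_of_real l) x)) \<le> M * cnorm x)"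

definition res_indiv_asym_pos :: "('r::{banach,ordered_real_vector,lattice} \<times> 'r) set \<Rightarrow> ('r \<times> 'r \<Rightarrow> 'r \<times> 'r) \<Rightarrow> real \<Rightarrow> bool" where
  "res_indiv_asym_pos D A l0 \<longleftrightarrow> resolvent_admissible D A l0 \<and>
     (\<forall>f\<in>pos_cone. ((\<lambda>l. (l - l0) * dplus (resolvent D A (complex_of_real l) f)) \<longlongrightarrow> 0) (at_right l0))"

definition res_unif_asym_pos_bdd :: "('r::{banach,ordered_real_vector,lattice} \<times> 'r) set \<Rightarrow> ('r \<times> 'r \<Rightarrow> 'r \<times> 'r) \<Rightarrow> real \<Rightarrow> bool" where
  "res_unif_asym_pos_bdd D A l0 \<longleftrightarrow> resolvent_admissible D A l0 \<and>
     (\<exists>l1>l0. \<exists>K\<ge>0. (\<forall>l\<in>{l0<..l1}. complex_of_real l \<in> resolvent_set D A) \<and>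
        (\<forall>f\<in>pos_cone. \<forall>l\<in>{l0<..l1}. dplus (resolvent D A (complex_of_real l) f) \<le> K * cnorm f))"

definition spectral_radius :: "('r::{banach,ordered_real_vector,lattice} \<times> 'r \<Rightarrow> 'r \<times> 'r) \<Rightarrow> real" where
  "spectral_radius T = Sup (cmod ` spectrum UNIV T)"

definition normalized_op :: "('r::{banach,ordered_real_vector,lattice} \<times> 'r \<Rightarrow> 'r \<times> 'r) \<Rightarrow> 'r \<times> 'r \<Rightarrow> 'r \<times> 'r" where
  "normalized_op T = (\<lambda>x. csc (complex_of_real (1 / spectral_radius T)) (T x))"

definition power_bounded :: "('r::{banach,ordered_real_vector,lattice} \<times> 'r \<Rightarrow> 'r \<times> 'r) \<Rightarrow> bool" where
  "power_bounded T \<longleftrightarrow> (\<exists>M. \<forall>n x. cnorm ((T ^^ n) x) \<le> M * cnorm x)"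

definition op_indiv_asym_pos :: "('r::{banach,ordered_real_vector,lattice} \<times> 'r \<Rightarrow> 'r \<times> 'r) \<Rightarrow> bool" where
  "op_indiv_asym_pos T \<longleftrightarrow> spectral_radius T > 0 \<and> power_bounded (normalized_op T) \<and>
     (\<forall>f\<in>pos_cone. (\<lambda>n. dplus ((normalized_op T ^^ n) f)) \<longlonglongrightarrow> 0)"

definition op_unif_asym_pos :: "('r::{banach,ordered_real_vector,lattice} \<times> 'r \<Rightarrow> 'r \<times> 'r) \<Rightarrow> bool" where
  "op_unif_asym_pos T \<longleftrightarrow> spectral_radius T > 0 \<and> power_bounded (normalized_op T) \<and>
     (\<forall>\<epsilon>>0. \<exists>n0. \<forall>n\<ge>n0. \<forall>f\<in>pos_cone. dplus ((normalized_op T ^^ n) f) \<le> \<epsilon> * cnorm f)"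

end

theory Submission
  imports Defs
begin

text \<open>At a simple pole the resolvent splits as \<open>R(l) = P / (l - l0) + B(l)\<close>, where \<open>P\<close> is a projection
  commuting with \<open>R(l)\<close> and \<open>B\<close> satisfies the resolvent identity and stays bounded near \<open>l0\<close>. Hence
  \<open>(l - l0) R(l) f\<close> tends to \<open>P f\<close> while \<open>R(l) f\<close> is at bounded distance from the multiple
  \<open>P f / (l - l0)\<close>, and since the cone is closed the positivity of \<open>P\<close> is equivalent to either
  notion of asymptotic positivity of the resolvent.

  If \<open>l0\<close> is the spectral bound and \<open>d = l - l0 > 0\<close>, then \<open>R(l)\<close> has spectral radius \<open>1/d\<close> and
  \<open>(d R(l))\<^sup>n = P + (d B(l))\<^sup>n\<close>. The remaining spectrum lies in the half plane \<open>Re z \<le> l0\<close> at distance at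
  least \<open>r\<close> from \<open>l0\<close>, hence at distance at least \<open>sqrt (d\<^sup>2 + r\<^sup>2) > d\<close> from \<open>l\<close>, so \<open>(d B(l))\<^sup>n\<close> tends
  to 0 in operator norm and the powers converge to \<open>P\<close>. No complex integration is needed: the decay
  is obtained by averaging the resolvent over roots of -1.\<close>

section \<open>Decay of powers without the spectral radius formula\<close>

text \<open>Scalar multiplication and norm are explicit parameters because the pair type already
  carries its own real structure and product norm, whereas the proof works with \<open>csc\<close>
  and \<open>cnorm\<close>.\<close>

locale complex_normed_space = vector_space scale
  for scale :: "complex \<Rightarrow> 'v::ab_group_add \<Rightarrow> 'v" (infixr "\<cdot>" 75) +
  fixes nrm :: "'v \<Rightarrow> real"
  assumes nrm_eq_0D: "nrm x = 0 \<Longrightarrow> x = 0"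
    and nrm_triangle: "nrm (x + y) \<le> nrm x + nrm y"
    and nrm_scale: "nrm (c \<cdot> x) = cmod c * nrm x"
begin

abbreviation linop :: "('v \<Rightarrow> 'v) \<Rightarrow> bool" where
  "linop T \<equiv> module_hom scale scale T"

lemma linopI:
  assumes "\<And>x y. T (x + y) = T x + T y" and "\<And>c x. T (c \<cdot> x) = c \<cdot> T x"
  shows "linop T"
  using assms by (simp add: module_hom_iff module_axioms)

lemma linop_add: "linop T \<Longrightarrow> T (x + y) = T x + T y"
  by (simp add: module_hom_iff)

lemma linop_scale: "linop T \<Longrightarrow> T (c \<cdot> x) = c \<cdot> T x"
  by (simp add: module_hom_iff)

lemma linop_diff: "linop T \<Longrightarrow> T (x - y) = T x - T y"
  by (rule module_hom.diff)

lemma linop_zero: "linop T \<Longrightarrow> T 0 = 0"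
  by (rule module_hom.zero)

lemma nrm_zero [simp]: "nrm 0 = 0"
  using nrm_scale[of 0 0] by simp

lemma nrm_minus [simp]: "nrm (- x) = nrm x"
  using nrm_scale[of "-1" x] by simp

lemma nrm_nonneg [simp]: "0 \<le> nrm x"
  using nrm_triangle[of x "- x"] by simp

lemma nrm_minus_commute: "nrm (x - y) = nrm (y - x)"
  using nrm_minus[of "x - y"] by simp

lemma nrm_diff_triangle: "nrm (x - y) \<le> nrm x + nrm y"
  using nrm_triangle[of x "- y"] by simp

lemma nrm_sum: "nrm (sum f I) \<le> (\<Sum>i\<in>I. nrm (f i))"
proof (induction I rule: infinite_finite_induct)
  case (insert i I)
  then show ?case
    using nrm_triangle[of "f i" "sum f I"] by simp
qed simp_all

section \<open>Convergence with respect to the abstract norm\<close>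

definition conv :: "('b \<Rightarrow> 'v) \<Rightarrow> 'v \<Rightarrow> 'b filter \<Rightarrow> bool" where
  "conv f a F \<longleftrightarrow> ((\<lambda>l. nrm (f l - a)) \<longlongrightarrow> 0) F"

lemma conv_unique:
  assumes "conv f a F" "conv f b F" "F \<noteq> bot"
  shows "a = b"
proof -
  have "((\<lambda>l. nrm (f l - a) + nrm (f l - b)) \<longlongrightarrow> 0 + 0) F"
    using assms unfolding conv_def by (intro tendsto_add)
  moreover have "nrm (a - b) \<le> nrm (f l - a) + nrm (f l - b)" for l
    using nrm_diff_triangle[of "f l - b" "f l - a"] by simp
  ultimately have "nrm (a - b) \<le> 0"
    using assms(3) by (intro tendsto_lowerbound[of _ 0 F]) auto
  then show ?thesis
    using nrm_eq_0D[of "a - b"] nrm_nonneg[of "a - b"] by simp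
qed

lemma conv_cong:
  assumes "conv f a F" "\<forall>\<^sub>F l in F. f l = g l"
  shows "conv g a F"
  using assms unfolding conv_def
  by (elim Lim_transform_eventually) (auto elim: eventually_mono)

lemma conv_const: "conv (\<lambda>_. a) a F"
  by (simp add: conv_def)

lemma conv_dominated:
  assumes "(h \<longlongrightarrow> 0) F" "\<And>l. nrm (g l - b) \<le> h l"
  shows "conv g b F"
  unfolding conv_def
  by (rule tendsto_sandwich[OF _ _ tendsto_const assms(1)]) (simp_all add: assms(2))

lemma conv_if_uniform:
  assumes "\<And>e. e > 0 \<Longrightarrow> \<forall>\<^sub>F l in F. nrm (f l - a) \<le> e * C"
  shows "conv f a F"
  unfolding conv_def
proof (rule tendstoI)
  fix e :: real assume e: "e > 0"
  \<comment> \<open>\<open>C\<close> may vanish or be negative; dividing by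
    \<open>\<bar>C\<bar> + 1\<close> avoids a case distinction and makes the final bound
    strict.\<close>
  have pos: "0 < \<bar>C\<bar> + 1"
    by simp
  have "e * C < e * (\<bar>C\<bar> + 1)"
    using e by (intro mult_strict_left_mono) auto
  then have small: "e / (\<bar>C\<bar> + 1) * C < e"
    using pos by (simp add: pos_divide_less_eq)
  from assms[OF divide_pos_pos[OF e pos]]
  show "\<forall>\<^sub>F l in F. dist (nrm (f l - a)) 0 < e"
    by (rule eventually_mono) (use small in simp)
qed

lemma conv_op:
  assumes "conv f a F" "linop T" "\<And>x. nrm (T x) \<le> K * nrm x"
  shows "conv (\<lambda>l. T (f l)) (T a) F"
proof (rule conv_dominated)
  show "((\<lambda>l. K * nrm (f l - a)) \<longlongrightarrow> 0) F"
    using assms(1) unfolding conv_def by (rule tendsto_mult_right_zero)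
  show "nrm (T (f l) - T a) \<le> K * nrm (f l - a)" for l
    unfolding linop_diff[OF assms(2), symmetric] by (rule assms(3))
qed

lemma conv_add:
  assumes "conv f a F" "conv g b F"
  shows "conv (\<lambda>l. f l + g l) (a + b) F"
proof (rule conv_dominated)
  show "((\<lambda>l. nrm (f l - a) + nrm (g l - b)) \<longlongrightarrow> 0) F"
    using assms unfolding conv_def by (rule tendsto_add_zero)
  show "nrm (f l + g l - (a + b)) \<le> nrm (f l - a) + nrm (g l - b)" for l
    unfolding add_diff_add by (rule nrm_triangle)
qed

lemma conv_scale:
  assumes "conv f a F" "(c \<longlongrightarrow> c') F"
  shows "conv (\<lambda>l. c l \<cdot> f l) (c' \<cdot> a) F"
proof (rule conv_dominated)
  have "((\<lambda>l. cmod (c l) * nrm (f l - a) + cmod (c l - c') * nrm a) \<longlongrightarrow> cmod c' * 0 + 0 * nrm a) F"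
    using assms(1) unfolding conv_def
    by (intro tendsto_add tendsto_mult tendsto_const tendsto_norm[OF assms(2)]
        tendsto_norm_zero[OF LIM_zero[OF assms(2)]])
  then show "((\<lambda>l. cmod (c l) * nrm (f l - a) + cmod (c l - c') * nrm a) \<longlongrightarrow> 0) F"
    by simp
  fix l
  have "c l \<cdot> f l - c' \<cdot> a = c l \<cdot> (f l - a) + (c l - c') \<cdot> a"
    by (simp add: scale_right_diff_distrib scale_left_diff_distrib)
  then show "nrm (c l \<cdot> f l - c' \<cdot> a) \<le> cmod (c l) * nrm (f l - a) + cmod (c l - c') * nrm a"
    using nrm_triangle[of "c l \<cdot> (f l - a)" "(c l - c') \<cdot> a"] by (simp add: nrm_scale)
qed

end

section \<open>Roots of -1 and their power sums\<close>

lemma cis_frac_ne_1: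
  assumes "0 < j" "j < n"
  shows "cis (2 * pi * real j / real n) \<noteq> 1"
proof
  assume "cis (2 * pi * real j / real n) = 1"
  then have eq: "cis (2 * pi * real j / real n) = cis (2 * pi * real 0 / real n)"
    by simp
  have "inj_on (\<lambda>k. cis (2 * pi * real k / real n)) {..<n}"
    using Complex.bij_betw_roots_unity[of n] assms by (simp add: bij_betw_def)
  from inj_onD[OF this eq] assms show False
    by simp
qed

definition root_neg1 :: "nat \<Rightarrow> nat \<Rightarrow> complex" where
  "root_neg1 n k = cis ((2 * real k + 1) * pi / real n)"

lemma norm_root_neg1 [simp]: "cmod (root_neg1 n k) = 1"
  by (simp add: root_neg1_def)

lemma root_neg1_power: "n > 0 \<Longrightarrow> root_neg1 n k ^ n = -1"
proof -
  assume "n > 0"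
  then have "real n * ((2 * real k + 1) * pi / real n) = (2 * real k + 1) * pi"
    by simp
  then have "root_neg1 n k ^ n = cis ((2 * real k + 1) * pi)"
    unfolding root_neg1_def Complex.DeMoivre by (rule arg_cong)
  also have "\<dots> = cis (2 * pi * real k) * cis pi"
    unfolding cis_mult by (rule arg_cong[where f = cis]) (simp add: algebra_simps)
  also have "\<dots> = -1"
    unfolding cis_multiple_2pi[OF Ints_of_nat] by simp
  finally show ?thesis .
qed

text \<open>Each root of -1 is one fixed root times a power of the basic n-th root of unity. The sum
  is therefore a multiple of a geometric sum with ratio \<open>q\<close>, where
  \<open>q ^ n = 1\<close> but \<open>q \<noteq> 1\<close>.\<close>

lemma sum_root_neg1_power:
  assumes "0 < j" "j < n"
  shows "(\<Sum>k<n. root_neg1 n k ^ j) = 0"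
proof -
  define q where "q = cis (2 * pi * real j / real n)"
  have q1: "q \<noteq> 1"
    unfolding q_def using assms by (rule cis_frac_ne_1)
  have "real n * (2 * pi * real j / real n) = 2 * pi * real j"
    using assms by simp
  then have "q ^ n = cis (2 * pi * real j)"
    unfolding q_def Complex.DeMoivre by (rule arg_cong)
  then have qn: "q ^ n = 1"
    unfolding cis_multiple_2pi[OF Ints_of_nat] .
  have "root_neg1 n k ^ j = cis (real j * pi / real n) * q ^ k" for k
    by (simp add: root_neg1_def q_def Complex.DeMoivre cis_mult add_divide_distrib algebra_simps)
  then have "(\<Sum>k<n. root_neg1 n k ^ j) = cis (real j * pi / real n) * (\<Sum>k<n. q ^ k)"
    by (simp add: sum_distrib_left)
  also have "(\<Sum>k<n. q ^ k) = 0"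
    using q1 qn by (simp add: geometric_sum)
  finally show ?thesis
    by simp
qed

text \<open>Comparing moduli forces \<open>s = d\<close>, so the root would be 1, whose n-th power
  is not -1. This keeps the sample points away from the point that corresponds to the pole.\<close>

lemma root_neg1_not_pos:
  assumes "s \<ge> 0" "d > 0" "n > 0"
  shows "of_real s * root_neg1 n k \<noteq> of_real d"
proof
  assume eq: "of_real s * root_neg1 n k = complex_of_real d"
  then have "cmod (of_real s * root_neg1 n k) = d"
    using assms by simp
  then have "s = d"
    using assms by (simp add: norm_mult)
  with eq assms have "root_neg1 n k = 1"
    by simp
  with root_neg1_power[OF assms(3), of k] show False
    by simp
qed

context complex_normed_space
begin

text \<open>This replaces Gelfand's spectral radius formula. The average \<open>V\<close> of \<open>F\<close> over the points
  \<open>s \<zeta>\<close> with \<open>\<zeta>\<^sup>n = -1\<close> inverts \<open>1 + s\<^sup>n S\<^sup>n\<close>, and it is Lipschitz in \<open>s\<close> uniformly in \<open>n\<close>. So if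
  \<open>t\<^sup>n S\<^sup>n\<close> tends to 0, then \<open>V\<close> stays close to the identity for \<open>s\<close> within a fixed distance of \<open>t\<close>,
  which makes \<open>s\<^sup>n S\<^sup>n\<close> bounded. Roots of -1 rather than of 1 are used because they never hit the
  exceptional point \<open>d\<close>.\<close>
lemma power_growth:
  fixes F :: "complex \<Rightarrow> 'v \<Rightarrow> 'v" and \<rho> d :: real
  assumes S: "linop S" and S_bdd: "\<And>x. nrm (S x) \<le> K * nrm x"
    and W: "\<And>w. w \<in> W \<longleftrightarrow> cmod w \<le> \<rho> \<and> w \<noteq> of_real d" and d: "0 < d"
    and F: "\<And>w. w \<in> W \<Longrightarrow> linop (F w)"
    and F_left: "\<And>w x. w \<in> W \<Longrightarrow> F w (x - w \<cdot> S x) = x"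
    and F_right: "\<And>w x. w \<in> W \<Longrightarrow> F w x - w \<cdot> S (F w x) = x"
    and F_bdd: "\<And>w x. w \<in> W \<Longrightarrow> nrm (F w x) \<le> M * nrm x"
    and s: "0 \<le> s" "s < \<rho>" and e: "0 < e"
  shows "\<exists>n0. \<forall>n\<ge>n0. \<forall>x. nrm (of_real (s ^ n) \<cdot> (S ^^ n) x) \<le> e * nrm x"
proof -
  define M' where "M' = max M 0"
  define K' where "K' = max K 0"
  have M': "0 \<le> M'" "nrm (F w x) \<le> M' * nrm x" if "w \<in> W" for w x
    unfolding M'_def by (simp, rule order_trans[OF F_bdd[OF that] mult_right_mono]) auto
  have M'0: "0 \<le> M'" and K'0: "0 \<le> K'"
    by (simp_all add: M'_def K'_def)
  have K': "nrm (S x) \<le> K' * nrm x" for x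
    unfolding K'_def by (rule order_trans[OF S_bdd mult_right_mono]) auto
  define L where "L = M' * K' * M'"
  have L0: "0 \<le> L"
    using M'0 K'0 by (simp add: L_def)
  \<comment> \<open>\<open>F w\<close> inverts \<open>1 - w S\<close>, so
    \<open>F w x - F v x = (w - v) F w (S (F v x))\<close>, as for resolvents. The constant
    \<open>L\<close> is the product of the three operator bounds.\<close>
  have F_lip: "nrm (F w x - F v x) \<le> cmod (w - v) * (L * nrm x)" if w: "w \<in> W" and v: "v \<in> W" for w v x
  proof -
    define y where "y = F v x"
    have "x = (y - w \<cdot> S y) + (w - v) \<cdot> S y"
      using F_right[OF v, of x] by (simp add: y_def algebra_simps)
    then have "F w x = F w ((y - w \<cdot> S y) + (w - v) \<cdot> S y)"
      by (rule arg_cong)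
    then have "F w x = F w (y - w \<cdot> S y) + F w ((w - v) \<cdot> S y)"
      unfolding linop_add[OF F[OF w]] .
    then have "F w x = y + (w - v) \<cdot> F w (S y)"
      by (simp add: F_left[OF w] linop_scale[OF F[OF w]])
    then have "nrm (F w x - F v x) = cmod (w - v) * nrm (F w (S y))"
      by (simp add: y_def nrm_scale)
    also have "nrm (F w (S y)) \<le> M' * nrm (S y)"
      by (rule M'(2)[OF w])
    also have "\<dots> \<le> M' * (K' * nrm y)"
      using K' M'0 by (intro mult_left_mono) auto
    also have "\<dots> \<le> M' * (K' * (M' * nrm x))"
      unfolding y_def using M'(2)[OF v] M'0 K'0 by (intro mult_left_mono) auto
    finally show ?thesis
      by (simp add: L_def mult_left_mono mult.assoc)
  qed
  define V where "V n s x = of_real (1 / real n) \<cdot> (\<Sum>k<n. F (of_real s * root_neg1 n k) x)" for n s x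
  have zW: "of_real s * root_neg1 n k \<in> W" if "0 \<le> s" "s \<le> \<rho>" "0 < n" for n k s
    unfolding W using root_neg1_not_pos[OF that(1) d that(3)] that by (simp add: norm_mult)
  have V_lin: "linop (V n s)" if "0 \<le> s" "s \<le> \<rho>" "0 < n" for n s
  proof (rule linopI)
    fix x y c
    show "V n s (x + y) = V n s x + V n s y"
      by (simp add: V_def linop_add[OF F[OF zW[OF that]]] sum.distrib scale_right_distrib)
    show "V n s (c \<cdot> x) = c \<cdot> V n s x"
      by (simp add: V_def linop_scale[OF F[OF zW[OF that]]] mult.commute flip: scale_sum_right)
  qed
  have avg_bound: "nrm (of_real (1 / real n) \<cdot> (\<Sum>k<n. f k)) \<le> C"
    if "\<And>k. k < n \<Longrightarrow> nrm (f k) \<le> C" "0 < n" for f :: "nat \<Rightarrow> 'v" and C n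
  proof -
    have "nrm (\<Sum>k<n. f k) \<le> (\<Sum>k<n. nrm (f k))"
      by (rule nrm_sum)
    also have "\<dots> \<le> (\<Sum>k<n. C)"
      using that by (intro sum_mono) auto
    finally show ?thesis
      using that(2) by (simp add: nrm_scale norm_divide field_simps)
  qed
  have V_bdd: "nrm (V n s x) \<le> M' * nrm x" if "0 \<le> s" "s \<le> \<rho>" "0 < n" for n s x
    unfolding V_def by (rule avg_bound) (use M'(2) zW that in auto)
  have V_lip: "nrm (V n s x - V n t x) \<le> \<bar>s - t\<bar> * (L * nrm x)"
    if "0 \<le> s" "s \<le> \<rho>" "0 \<le> t" "t \<le> \<rho>" "0 < n" for n and s t :: real and x
  proof -
    have "V n s x - V n t x
      = of_real (1 / real n) \<cdot> (\<Sum>k<n. F (of_real s * root_neg1 n k) x - F (of_real t * root_neg1 n k) x)"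
      by (simp add: V_def sum_subtractf scale_right_diff_distrib)
    moreover have "nrm (F (of_real s * root_neg1 n k) x - F (of_real t * root_neg1 n k) x) \<le> \<bar>s - t\<bar> * (L * nrm x)" for k
    proof -
      have "cmod (of_real s * root_neg1 n k - of_real t * root_neg1 n k) = cmod (of_real (s - t) * root_neg1 n k)"
        by (simp add: algebra_simps)
      also have "\<dots> = \<bar>s - t\<bar>"
        by (simp add: norm_mult del: of_real_diff)
      finally show ?thesis
        using F_lip[of "of_real s * root_neg1 n k" "of_real t * root_neg1 n k" x]
          zW[OF that(1,2,5)] zW[OF that(3,4,5)] by simp
    qed
    ultimately show ?thesis
      using avg_bound that(5) by presburger
  qed
  \<comment> \<open>Since the n-th power of \<open>w = s * root_neg1 n k\<close> is
    \<open>- (s ^ n)\<close>, the vector \<open>x + s ^ n S ^^ n x\<close> is \<open>1 - w S\<close>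
    applied to the geometric sum of the \<open>w ^ j S ^^ j x\<close> with \<open>j < n\<close>.
    Hence \<open>F w\<close> returns that sum, and averaging over \<open>k\<close> cancels every
    term except \<open>j = 0\<close>.\<close>
  have V_inv: "V n s (x + of_real (s ^ n) \<cdot> (S ^^ n) x) = x" if "0 \<le> s" "s \<le> \<rho>" "0 < n" for n s x
  proof -
    have Fk: "F (of_real s * root_neg1 n k) (x + of_real (s ^ n) \<cdot> (S ^^ n) x)
      = (\<Sum>j<n. (of_real s * root_neg1 n k) ^ j \<cdot> (S ^^ j) x)" for k
    proof -
      define w where "w = of_real s * root_neg1 n k"
      define g where "g m = (\<Sum>j<m. w ^ j \<cdot> (S ^^ j) x)" for m
      have "g m - w \<cdot> S (g m) = x - w ^ m \<cdot> (S ^^ m) x" for m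
      proof (induction m)
        case (Suc m)
        have "g (Suc m) - w \<cdot> S (g (Suc m))
          = (g m - w \<cdot> S (g m)) + (w ^ m \<cdot> (S ^^ m) x - w ^ Suc m \<cdot> (S ^^ Suc m) x)"
          by (simp add: g_def linop_add[OF S] linop_scale[OF S] algebra_simps)
        also have "\<dots> = x - w ^ Suc m \<cdot> (S ^^ Suc m) x"
          unfolding Suc.IH by simp
        finally show ?case .
      qed (simp add: g_def linop_zero[OF S])
      from this[of n] have "g n - w \<cdot> S (g n) = x + of_real (s ^ n) \<cdot> (S ^^ n) x"
        by (simp add: w_def power_mult_distrib root_neg1_power that)
      then have "F w (x + of_real (s ^ n) \<cdot> (S ^^ n) x) = g n"
        using F_left[of w "g n"] zW[OF that, of k] by (simp add: w_def)
      then show ?thesis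
        by (simp add: w_def g_def)
    qed
    have "(\<Sum>k<n. \<Sum>j<n. (of_real s * root_neg1 n k) ^ j \<cdot> (S ^^ j) x)
      = (\<Sum>j<n. \<Sum>k<n. (of_real s * root_neg1 n k) ^ j \<cdot> (S ^^ j) x)"
      by (rule sum.swap)
    also have "\<dots> = (\<Sum>j<n. (of_real (s ^ j) * (\<Sum>k<n. root_neg1 n k ^ j)) \<cdot> (S ^^ j) x)"
      by (simp add: power_mult_distrib sum_distrib_left flip: scale_sum_left)
    also have "\<dots> = (\<Sum>j<n. if j = 0 then of_nat n \<cdot> x else 0)"
      by (intro sum.cong) (auto simp: sum_root_neg1_power)
    also have "\<dots> = of_nat n \<cdot> x"
      using that by simp
    finally show ?thesis
      using that unfolding V_def Fk by simp
  qed
  \<comment> \<open>\<open>G t\<close> says that the operators \<open>t ^ n S ^^ n\<close> tend to 0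
    in operator norm. The set of such \<open>t\<close> is now extended from 0 up to every
    \<open>s < \<rho>\<close> in steps of fixed length.\<close>
  define G where "G t \<longleftrightarrow> (\<forall>e>0. \<exists>n0. \<forall>n\<ge>n0. \<forall>x. nrm (of_real (t ^ n) \<cdot> (S ^^ n) x) \<le> e * nrm x)" for t
  \<comment> \<open>Decay at \<open>t\<close> puts \<open>V n t\<close> within 1/4 of the identity,
    and the Lipschitz bound adds at most another 1/4 for \<open>V n s\<close>. Applying this to
    \<open>y = x + s ^ n S ^^ n x\<close>, for which \<open>V n s y = x\<close>, bounds the norm of
    \<open>s ^ n S ^^ n x\<close> by half of itself plus half the norm of \<open>x\<close>.\<close>
  have bounded_step: "\<exists>n0. \<forall>n\<ge>n0. \<forall>x. nrm (of_real (s ^ n) \<cdot> (S ^^ n) x) \<le> nrm x"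
    if t: "0 \<le> t" "t \<le> \<rho>" "G t" and s: "0 \<le> s" "s \<le> \<rho>" and st: "\<bar>s - t\<bar> * L \<le> 1/4" for s t
  proof -
    have "0 < 1 / (4 * (M' + 1))"
      using M'0 by simp
    with t(3) obtain n0 where n0: "\<And>n x. n \<ge> n0 \<Longrightarrow> nrm (of_real (t ^ n) \<cdot> (S ^^ n) x) \<le> 1 / (4 * (M' + 1)) * nrm x"
      unfolding G_def by blast
    \<comment> \<open>The successor guarantees \<open>n > 0\<close>, without which the average
      \<open>V n s\<close> makes no sense.\<close>
    have "nrm (of_real (s ^ n) \<cdot> (S ^^ n) x) \<le> nrm x" if n: "n \<ge> Suc n0" for n x
    proof -
      have npos: "0 < n" and nn0: "n \<ge> n0"
        using n by auto
      have near: "nrm (V n s y - y) \<le> 1/2 * nrm y" for y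
      proof -
        have "V n t y + V n t (of_real (t ^ n) \<cdot> (S ^^ n) y) = y"
          using V_inv[OF t(1,2) npos, of y]
          unfolding linop_add[OF V_lin[OF t(1,2) npos]] .
        then have "V n t y - y = - V n t (of_real (t ^ n) \<cdot> (S ^^ n) y)"
          by (simp add: algebra_simps eq_neg_iff_add_eq_0)
        then have "nrm (V n t y - y) \<le> M' * nrm (of_real (t ^ n) \<cdot> (S ^^ n) y)"
          using V_bdd[OF t(1,2) npos] by simp
        also have "\<dots> \<le> M' * (1 / (4 * (M' + 1)) * nrm y)"
          using n0[OF nn0] M'0 by (intro mult_left_mono) auto
        also have "\<dots> = M' / (M' + 1) * (nrm y / 4)"
          by (simp add: field_simps)
        also have "\<dots> \<le> 1 * (nrm y / 4)"
          using M'0 by (intro mult_right_mono) auto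
        finally have A: "nrm (V n t y - y) \<le> nrm y / 4"
          by simp
        have "nrm (V n s y - V n t y) \<le> (\<bar>s - t\<bar> * L) * nrm y"
          using V_lip[OF s t(1,2) npos, of y] by (simp add: mult.assoc)
        also have "\<dots> \<le> 1/4 * nrm y"
          using st by (intro mult_right_mono) auto
        finally have "nrm (V n s y - V n t y) \<le> 1/4 * nrm y" .
        with A nrm_triangle[of "V n s y - V n t y" "V n t y - y"] show ?thesis
          by simp
      qed
      define y where "y = x + of_real (s ^ n) \<cdot> (S ^^ n) x"
      have "nrm (of_real (s ^ n) \<cdot> (S ^^ n) x) = nrm (x - y)"
        using nrm_minus_commute[of x y] by (simp add: y_def)
      also have "\<dots> \<le> 1/2 * nrm y"
        using near[of y] V_inv[OF s npos, of x] by (simp add: y_def)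
      also have "\<dots> \<le> 1/2 * (nrm x + nrm (of_real (s ^ n) \<cdot> (S ^^ n) x))"
        using nrm_triangle[of x "of_real (s ^ n) \<cdot> (S ^^ n) x"] by (simp add: y_def)
      finally show ?thesis
        by simp
    qed
    then show ?thesis
      by blast
  qed
  \<comment> \<open>Boundedness at \<open>s1\<close> becomes decay at every smaller \<open>s\<close>
    through the geometric factor \<open>(s / s1) ^ n\<close>.\<close>
  have G_below: "G s" if bd: "\<exists>n0. \<forall>n\<ge>n0. \<forall>x. nrm (of_real (s1 ^ n) \<cdot> (S ^^ n) x) \<le> nrm x"
    and s: "0 \<le> s" "s < s1" for s s1
    unfolding G_def
  proof (intro allI impI)
    fix e :: real assume e: "e > 0"
    from bd obtain n0 where n0: "\<And>n x. n \<ge> n0 \<Longrightarrow> nrm (of_real (s1 ^ n) \<cdot> (S ^^ n) x) \<le> nrm x"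
      by blast
    have "(\<lambda>n. (s / s1) ^ n) \<longlonglongrightarrow> 0"
      using s by (intro LIMSEQ_power_zero) auto
    then have "\<forall>\<^sub>F n in sequentially. (s / s1) ^ n < e"
      using e by (rule order_tendstoD)
    then obtain n1 where n1: "\<And>n. n \<ge> n1 \<Longrightarrow> (s / s1) ^ n < e"
      by (auto simp: eventually_sequentially)
    have "nrm (of_real (s ^ n) \<cdot> (S ^^ n) x) \<le> e * nrm x" if n: "n \<ge> max n0 n1" for n x
    proof -
      have "nrm (of_real (s ^ n) \<cdot> (S ^^ n) x) = (s / s1) ^ n * nrm (of_real (s1 ^ n) \<cdot> (S ^^ n) x)"
        using s by (simp add: nrm_scale norm_power power_divide)
      also have "\<dots> \<le> (s / s1) ^ n * nrm x"
        using n0[of n x] n s by (intro mult_left_mono) auto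
      also have "\<dots> \<le> e * nrm x"
        using n1[of n] n by (intro mult_right_mono) auto
      finally show ?thesis .
    qed
    then show "\<exists>n0. \<forall>n\<ge>n0. \<forall>x. nrm (of_real (s ^ n) \<cdot> (S ^^ n) x) \<le> e * nrm x"
      by blast
  qed
  \<comment> \<open>The step length depends neither on \<open>n\<close> nor on the current point.
    Half of it advances \<open>s\<close>; the other half leaves room for a point
    \<open>s1 > s\<close> at which mere boundedness is shown.\<close>
  define \<eta> where "\<eta> = 1 / (4 * (L + 1))"
  have \<eta>: "0 < \<eta>" "\<eta> * L \<le> 1/4"
    using L0 by (simp_all add: \<eta>_def field_simps)
  have "G s" if "0 \<le> s" "s < \<rho>" "s \<le> real k * (\<eta> / 2)" for k s
    using that
  proof (induction k arbitrary: s)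
    case 0
    \<comment> \<open>Here \<open>s ^ n\<close> vanishes only from \<open>n = 1\<close> on, hence
      the threshold 1.\<close>
    then have "s = 0"
      by simp
    then show ?case
      unfolding G_def by (auto simp: power_0_left intro!: exI[of _ 1])
  next
    case (Suc k)
    define t where "t = min s (real k * (\<eta> / 2))"
    define s1 where "s1 = min \<rho> (s + \<eta> / 2)"
    have "G t"
      using Suc.prems \<eta>(1) by (intro Suc.IH) (auto simp: t_def)
    have t: "0 \<le> t" "t \<le> \<rho>" and s1: "0 \<le> s1" "s1 \<le> \<rho>" "s < s1"
      using Suc.prems \<eta>(1) by (auto simp: t_def s1_def)
    have "\<bar>s1 - t\<bar> \<le> \<eta>"
      using Suc.prems \<eta>(1) by (auto simp: t_def s1_def min_def algebra_simps)
    then have "\<bar>s1 - t\<bar> * L \<le> \<eta> * L"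
      using L0 by (intro mult_right_mono) auto
    with \<eta>(2) have "\<bar>s1 - t\<bar> * L \<le> 1/4"
      by simp
    from bounded_step[OF t \<open>G t\<close> s1(1,2) this] show ?case
      by (rule G_below) (use Suc.prems s1 in auto)
  qed
  moreover obtain k where "s / (\<eta> / 2) \<le> real k"
    using real_arch_simple by blast
  then have "s \<le> real k * (\<eta> / 2)"
    using \<eta>(1) by (simp add: field_simps)
  ultimately have "G s"
    using s by blast
  then show ?thesis
    using e unfolding G_def by blast
qed

end

section \<open>Resolvents with a simple pole\<close>

text \<open>Only a family satisfying the resolvent identity and its behaviour near \<open>l0\<close>
  enter here; the underlying operator is not mentioned.\<close>

locale simple_pole_resolvent = complex_normed_space scale nrm
  for scale :: "complex \<Rightarrow> 'v::ab_group_add \<Rightarrow> 'v" (infixr "\<cdot>" 75) and nrm :: "'v \<Rightarrow> real" +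
  fixes G :: "complex set" and R :: "complex \<Rightarrow> 'v \<Rightarrow> 'v" and l0 :: complex and P :: "'v \<Rightarrow> 'v"
    and r :: real
  assumes R_lin: "l \<in> G \<Longrightarrow> linop (R l)"
    and R_bdd: "l \<in> G \<Longrightarrow> \<exists>K. \<forall>x. nrm (R l x) \<le> K * nrm x"
    and resolvent_identity: "l \<in> G \<Longrightarrow> m \<in> G \<Longrightarrow> R l x - R m x = (m - l) \<cdot> R l (R m x)"
    and r: "0 < r" "ball l0 r - {l0} \<subseteq> G"
    and l0_notin: "l0 \<notin> G"
    and P_bdd: "\<exists>K. \<forall>x. nrm (P x) \<le> K * nrm x"
    and P_lim: "\<And>e. e > 0 \<Longrightarrow> \<forall>\<^sub>F l in at l0. \<forall>x. nrm ((l - l0) \<cdot> R l x - P x) \<le> e * nrm x"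
begin

lemma eventually_G: "\<forall>\<^sub>F l in at l0. l \<in> G"
  using r unfolding eventually_at by (intro exI[of _ r]) (auto simp: dist_commute)

lemma conv_residue:
  assumes "\<And>e. e > 0 \<Longrightarrow> \<forall>\<^sub>F l in at l0. \<forall>x. nrm ((l - l0) \<cdot> R l x - Q x) \<le> e * nrm x"
  shows "conv (\<lambda>l. (l - l0) \<cdot> R l x) (Q x) (at l0)"
proof (rule conv_if_uniform)
  fix e :: real assume "e > 0"
  from assms[OF this] show "\<forall>\<^sub>F l in at l0. nrm ((l - l0) \<cdot> R l x - Q x) \<le> e * nrm x"
    by (rule eventually_mono) blast
qed

lemma P_conv: "conv (\<lambda>l. (l - l0) \<cdot> R l x) (P x) (at l0)"
  by (rule conv_residue) (rule P_lim)

text \<open>Limits in norm are unique; this later evaluates the definite description in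
  \<open>residue_op\<close>.\<close>

lemma P_unique:
  assumes "\<And>e. e > 0 \<Longrightarrow> \<forall>\<^sub>F l in at l0. \<forall>x. nrm ((l - l0) \<cdot> R l x - Q x) \<le> e * nrm x"
  shows "Q = P"
  using conv_unique[OF conv_residue[OF assms] P_conv] by (intro ext) simp

lemma P_lin: "linop P"
proof (rule linopI)
  fix x y c
  have "conv (\<lambda>l. (l - l0) \<cdot> R l (x + y)) (P x + P y) (at l0)"
    by (rule conv_cong[OF conv_add[OF P_conv P_conv] eventually_mono[OF eventually_G]])
      (simp add: linop_add[OF R_lin] scale_right_distrib)
  then show "P (x + y) = P x + P y"
    by (rule conv_unique[OF P_conv]) simp
  have "conv (\<lambda>l. (l - l0) \<cdot> R l (c \<cdot> x)) (c \<cdot> P x) (at l0)"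
    by (rule conv_cong[OF conv_scale[OF P_conv tendsto_const] eventually_mono[OF eventually_G]])
      (simp add: linop_scale[OF R_lin] mult.commute)
  then show "P (c \<cdot> x) = c \<cdot> P x"
    by (rule conv_unique[OF P_conv]) simp
qed

text \<open>Exchanging the two points changes the sign of both sides of the resolvent
  identity.\<close>

lemma R_commute:
  assumes "l \<in> G" "m \<in> G"
  shows "R l (R m x) = R m (R l x)"
proof (cases "l = m")
  case False
  have "(m - l) \<cdot> R l (R m x) = - (R m x - R l x)"
    using resolvent_identity[OF assms, of x] by simp
  also have "\<dots> = (m - l) \<cdot> R m (R l x)"
    unfolding resolvent_identity[OF assms(2,1)] by (simp flip: scale_minus_left)
  finally show ?thesis
    using False by (simp add: scale_left_imp_eq)
qed simp

text \<open>Multiply the resolvent identity by \<open>l - l0\<close> and let \<open>l\<close> tend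
  to \<open>l0\<close>: the term with \<open>R m x\<close> disappears. The two formulas come from
  the two orders of the commuting product of resolvents.\<close>

lemma P_eq_scaled:
  assumes m: "m \<in> G"
  shows "P x = (m - l0) \<cdot> R m (P x)" and "P x = (m - l0) \<cdot> P (R m x)"
proof -
  have "((\<lambda>l. l - l0) \<longlongrightarrow> l0 - l0) (at l0)"
    by (intro tendsto_intros)
  then have z: "((\<lambda>l. l - l0) \<longlongrightarrow> 0) (at l0)"
    by simp
  have ml: "((\<lambda>l. m - l) \<longlongrightarrow> m - l0) (at l0)"
    by (intro tendsto_intros)
  have lhs: "conv (\<lambda>l. (l - l0) \<cdot> R l x + (l - l0) \<cdot> (- R m x)) (P x + 0 \<cdot> (- R m x)) (at l0)"
    by (rule conv_add[OF P_conv conv_scale[OF conv_const z]])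
  have eq: "(l - l0) \<cdot> R l x + (l - l0) \<cdot> (- R m x) = (m - l) \<cdot> (l - l0) \<cdot> R l (R m x)" if "l \<in> G" for l
  proof -
    have "(l - l0) \<cdot> (R l x - R m x) = (l - l0) \<cdot> (m - l) \<cdot> R l (R m x)"
      by (simp only: resolvent_identity[OF that m])
    then show ?thesis
      by (simp add: scale_right_diff_distrib mult.commute)
  qed
  have eq': "(l - l0) \<cdot> R l x + (l - l0) \<cdot> (- R m x) = (m - l) \<cdot> R m ((l - l0) \<cdot> R l x)" if "l \<in> G" for l
    unfolding eq[OF that] R_commute[OF that m] linop_scale[OF R_lin[OF m]] ..
  obtain K where K: "\<And>x. nrm (R m x) \<le> K * nrm x"
    using R_bdd[OF m] by blast
  have "conv (\<lambda>l. (m - l) \<cdot> (l - l0) \<cdot> R l (R m x)) ((m - l0) \<cdot> P (R m x)) (at l0)"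
    by (rule conv_scale[OF P_conv ml])
  moreover have "conv (\<lambda>l. (m - l) \<cdot> (l - l0) \<cdot> R l (R m x)) (P x + 0 \<cdot> (- R m x)) (at l0)"
    by (rule conv_cong[OF lhs eventually_mono[OF eventually_G eq]])
  ultimately show "P x = (m - l0) \<cdot> P (R m x)"
    using conv_unique at_neq_bot by fastforce
  have "conv (\<lambda>l. (m - l) \<cdot> R m ((l - l0) \<cdot> R l x)) ((m - l0) \<cdot> R m (P x)) (at l0)"
    by (rule conv_scale[OF conv_op[OF P_conv R_lin[OF m] K] ml])
  moreover have "conv (\<lambda>l. (m - l) \<cdot> R m ((l - l0) \<cdot> R l x)) (P x + 0 \<cdot> (- R m x)) (at l0)"
    by (rule conv_cong[OF lhs eventually_mono[OF eventually_G eq']])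
  ultimately show "P x = (m - l0) \<cdot> R m (P x)"
    using conv_unique at_neq_bot by fastforce
qed

lemma ne_l0: "m \<in> G \<Longrightarrow> m \<noteq> l0"
  using l0_notin by blast

lemma R_P: "m \<in> G \<Longrightarrow> R m (P x) = (1 / (m - l0)) \<cdot> P x"
  using P_eq_scaled(1)[of m x] ne_l0[of m]
  by (metis scale_scale scale_one nonzero_divide_eq_eq right_minus_eq)

lemma P_R: "m \<in> G \<Longrightarrow> P (R m x) = (1 / (m - l0)) \<cdot> P x"
  using P_eq_scaled(2)[of m x] ne_l0[of m]
  by (metis scale_scale scale_one nonzero_divide_eq_eq right_minus_eq)

text \<open>On the range of \<open>P\<close> the scaled resolvents already equal the identity, so
  their limit does too.\<close>

lemma P_idem: "P (P x) = P x"
proof -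
  have "conv (\<lambda>l. (l - l0) \<cdot> R l (P x)) (P x) (at l0)"
    by (rule conv_cong[OF conv_const eventually_mono[OF eventually_G]]) (rule P_eq_scaled(1))
  then show ?thesis
    by (rule conv_unique[OF P_conv]) simp
qed

section \<open>The regular part of the Laurent expansion at the pole\<close>

definition B :: "complex \<Rightarrow> 'v \<Rightarrow> 'v" where
  "B l x = R l x - (1 / (l - l0)) \<cdot> P x"

lemma B_lin: "l \<in> G \<Longrightarrow> linop (B l)"
  by (rule linopI)
    (simp_all add: B_def linop_add[OF R_lin] linop_add[OF P_lin] linop_scale[OF R_lin]
      linop_scale[OF P_lin] scale_right_distrib scale_right_diff_distrib mult.commute)

lemma P_B: "l \<in> G \<Longrightarrow> P (B l x) = 0"
  by (simp add: B_def linop_diff[OF P_lin] linop_scale[OF P_lin] P_R P_idem)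

lemma B_P: "l \<in> G \<Longrightarrow> B l (P x) = 0"
  by (simp add: B_def R_P P_idem)

text \<open>As \<open>P\<close> annihilates the range of \<open>B m\<close>, the product
  \<open>B l (B m x)\<close> differs from \<open>R l (R m x)\<close> only by a multiple of
  \<open>P x\<close>, and a partial fraction decomposition matches that multiple with the principal
  parts.\<close>

lemma B_identity:
  assumes l: "l \<in> G" and m: "m \<in> G"
  shows "B l x - B m x = (m - l) \<cdot> B l (B m x)"
proof -
  have "B l (B m x) = R l (R m x) - (1 / (m - l0)) \<cdot> (1 / (l - l0)) \<cdot> P x"
    unfolding B_def[of l] P_B[OF m]
    by (simp add: B_def linop_diff[OF R_lin[OF l]] linop_scale[OF R_lin[OF l]] R_P[OF l])
  then have "(m - l) \<cdot> B l (B m x)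
    = (R l x - R m x) - ((m - l) * (1 / (m - l0)) * (1 / (l - l0))) \<cdot> P x"
    unfolding resolvent_identity[OF l m] by (simp add: scale_right_diff_distrib)
  also have "(m - l) * (1 / (m - l0)) * (1 / (l - l0)) = 1 / (l - l0) - 1 / (m - l0)"
    using ne_l0[OF l] ne_l0[OF m] by (simp add: field_simps)
  finally show ?thesis
    by (simp add: B_def scale_left_diff_distrib)
qed

lemma B_bdd:
  assumes l: "l \<in> G"
  shows "\<exists>K\<ge>0. \<forall>x. nrm (B l x) \<le> K * nrm x"
proof -
  obtain K K' where K: "\<And>x. nrm (R l x) \<le> K * nrm x" and K': "\<And>x. nrm (P x) \<le> K' * nrm x"
    using R_bdd[OF l] P_bdd by blast
  define C where "C = K + cmod (1 / (l - l0)) * K'"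
  have *: "nrm (B l x) \<le> C * nrm x" for x
  proof -
    have "nrm (B l x) \<le> nrm (R l x) + cmod (1 / (l - l0)) * nrm (P x)"
      using nrm_diff_triangle[of "R l x" "(1 / (l - l0)) \<cdot> P x"] by (simp only: B_def nrm_scale)
    also have "\<dots> \<le> K * nrm x + cmod (1 / (l - l0)) * (K' * nrm x)"
      using K K' by (intro add_mono mult_left_mono) auto
    finally show ?thesis
      by (simp add: C_def algebra_simps)
  qed
  have "nrm (B l x) \<le> \<bar>C\<bar> * nrm x" for x
    by (rule order_trans[OF *]) (rule mult_right_mono, auto)
  then show ?thesis
    by (intro exI[of _ "\<bar>C\<bar>"]) auto
qed

text \<open>In \<open>B m x = B l x - (m - l) B l (B m x)\<close> the last term has at most half the
  norm of \<open>B m x\<close> and can be absorbed into the left-hand side.\<close>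

lemma B_local_bound:
  assumes l: "l \<in> G" and m: "m \<in> G" and K: "\<And>x. nrm (B l x) \<le> K * nrm x" and near: "cmod (m - l) * K \<le> 1/2"
  shows "nrm (B m x) \<le> 2 * K * nrm x"
proof -
  have "B m x = B l x - (m - l) \<cdot> B l (B m x)"
    using B_identity[OF l m, of x] by (simp add: algebra_simps)
  then have "nrm (B m x) \<le> nrm (B l x) + cmod (m - l) * nrm (B l (B m x))"
    using nrm_diff_triangle[of "B l x" "(m - l) \<cdot> B l (B m x)"] by (simp add: nrm_scale)
  also have "\<dots> \<le> K * nrm x + cmod (m - l) * (K * nrm (B m x))"
    using K by (intro add_mono mult_left_mono) auto
  also have "\<dots> = K * nrm x + (cmod (m - l) * K) * nrm (B m x)"
    by simp
  also have "\<dots> \<le> K * nrm x + 1/2 * nrm (B m x)"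
    using near by (intro add_left_mono mult_right_mono) auto
  finally show ?thesis
    by simp
qed

text \<open>Close to the pole \<open>(l - l0) \<cdot> B l\<close> is small, so the resolvent identity for \<open>B\<close> propagates the bound at
  one point to a whole punctured neighbourhood.\<close>
lemma B_near_pole:
  "\<exists>e>0. \<exists>K\<ge>0. \<forall>m. m \<noteq> l0 \<and> dist m l0 < e \<longrightarrow> m \<in> G \<and> (\<forall>x. nrm (B m x) \<le> K * nrm x)"
proof -
  have "\<forall>\<^sub>F l in at l0. \<forall>x. nrm ((l - l0) \<cdot> R l x - P x) \<le> 1/4 * nrm x"
    by (rule P_lim) simp
  then obtain d where d: "d > 0"
    "\<And>l x. l \<noteq> l0 \<Longrightarrow> dist l l0 < d \<Longrightarrow> nrm ((l - l0) \<cdot> R l x - P x) \<le> 1/4 * nrm x"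
    unfolding eventually_at by auto
  \<comment> \<open>At the base point \<open>l = l0 + e\<close> the bound 1/4 turns into
    \<open>1 / (4 * e)\<close> for \<open>B l\<close>. Every \<open>m\<close> within
    \<open>e\<close> of \<open>l0\<close> is within \<open>2 * e\<close> of \<open>l\<close>, which
    is exactly what \<open>B_local_bound\<close> tolerates.\<close>
  define e where "e = min d r / 2"
  define l where "l = l0 + of_real e"
  have e: "e > 0" "e < d" "e < r"
    using d(1) r(1) by (auto simp: e_def)
  have lG: "l \<in> G" and l: "l \<noteq> l0" "dist l l0 < d"
    using e r(2) by (auto simp: l_def dist_norm)
  have K: "nrm (B l x) \<le> 1 / (4 * e) * nrm x" for x
  proof -
    have "(l - l0) \<cdot> B l x = (l - l0) \<cdot> R l x - P x"
      using l(1) by (simp add: B_def scale_right_diff_distrib)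
    then have "cmod (l - l0) * nrm (B l x) \<le> 1/4 * nrm x"
      using d(2)[OF l, of x] by (simp flip: nrm_scale)
    then show ?thesis
      using e(1) by (simp add: l_def field_simps)
  qed
  have "m \<in> G \<and> (\<forall>x. nrm (B m x) \<le> 2 * (1 / (4 * e)) * nrm x)" if m: "m \<noteq> l0" "dist m l0 < e" for m
  proof (intro conjI allI)
    show mG: "m \<in> G"
      using m e r(2) by (auto simp: dist_commute)
    have "cmod (m - l) \<le> dist m l0 + dist l0 l"
      by (metis dist_norm dist_triangle)
    also have "\<dots> \<le> 2 * e"
      using m e by (simp add: l_def dist_norm)
    finally have "cmod (m - l) * (1 / (4 * e)) \<le> 1/2"
      using e(1) by (simp add: field_simps)
    then show "nrm (B m x) \<le> 2 * (1 / (4 * e)) * nrm x" for x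
      by (rule B_local_bound[OF lG mG K])
  qed
  then show ?thesis
    using e(1) by (intro exI[of _ e] conjI exI[of _ "2 * (1 / (4 * e))"]) auto
qed

text \<open>Local bounds, around the pole from \<open>B_near_pole\<close> and elsewhere from
  \<open>B_local_bound\<close>, are combined over a finite subcover. The sum of the finitely many
  nonnegative constants serves as the common bound.\<close>

lemma B_compact_bound:
  assumes C: "compact C" "C - {l0} \<subseteq> G"
  shows "\<exists>M. \<forall>m\<in>C - {l0}. \<forall>x. nrm (B m x) \<le> M * nrm x"
proof -
  have "\<exists>e>0. \<exists>K\<ge>0. \<forall>m\<in>C - {l0}. dist c m < e \<longrightarrow> (\<forall>x. nrm (B m x) \<le> K * nrm x)" if c: "c \<in> C" for c
  proof (cases "c = l0")
    case True
    then show ?thesis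
      using B_near_pole by (simp add: dist_commute) blast
  next
    case False
    then have cG: "c \<in> G"
      using c C(2) by blast
    obtain K where K: "K \<ge> 0" "\<And>x. nrm (B c x) \<le> K * nrm x"
      using B_bdd[OF cG] by blast
    have "nrm (B m x) \<le> 2 * K * nrm x" if m: "m \<in> C - {l0}" "dist c m < 1 / (2 * (K + 1))" for m x
    proof (rule B_local_bound[OF cG _ K(2)])
      show "m \<in> G"
        using m C(2) by blast
      have "cmod (m - c) * K \<le> 1 / (2 * (K + 1)) * K"
        using m K(1) by (intro mult_right_mono) (auto simp: dist_norm norm_minus_commute)
      also have "\<dots> \<le> 1/2"
        using K(1) by (simp add: field_simps)
      finally show "cmod (m - c) * K \<le> 1/2" .
    qed
    moreover have "1 / (2 * (K + 1)) > 0" "2 * K \<ge> 0"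
      using K(1) by auto
    ultimately show ?thesis
      by blast
  qed
  then obtain e K where eK: "\<And>c. c \<in> C \<Longrightarrow> e c > 0" "\<And>c. c \<in> C \<Longrightarrow> K c \<ge> 0"
    "\<And>c m x. c \<in> C \<Longrightarrow> m \<in> C - {l0} \<Longrightarrow> dist c m < e c \<Longrightarrow> nrm (B m x) \<le> K c * nrm x"
    by metis
  obtain C' where C': "C' \<subseteq> C" "finite C'" "C \<subseteq> (\<Union>c\<in>C'. ball c (e c))"
  proof (rule compactE_image[OF C(1), of C "\<lambda>c. ball c (e c)"])
    show "C \<subseteq> (\<Union>c\<in>C. ball c (e c))"
      using eK(1) by force
  qed auto
  have "nrm (B m x) \<le> sum K C' * nrm x" if m: "m \<in> C - {l0}" for m x
  proof -
    obtain c where c: "c \<in> C'" "dist c m < e c"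
      using m C'(3) by auto
    have "nrm (B m x) \<le> K c * nrm x"
      using c C'(1) m by (intro eK(3)) auto
    also have "\<dots> \<le> sum K C' * nrm x"
      using c C'(1,2) eK(2) by (intro mult_right_mono member_le_sum) auto
    finally show ?thesis .
  qed
  then show ?thesis
    by blast
qed

text \<open>An instance of \<open>power_growth\<close> at \<open>s = d\<close>: the disc around
  \<open>l\<close> reaches strictly beyond the pole, and the excluded parameter \<open>w = d\<close>
  is the one with \<open>l - w = l0\<close>.\<close>

lemma B_powers_tendsto_0:
  assumes lG: "l \<in> G" and d: "l - l0 = of_real d" "0 < d" "d < \<rho>" and C: "cball l \<rho> - {l0} \<subseteq> G" and e: "0 < e"
  shows "\<exists>n0. \<forall>n\<ge>n0. \<forall>x. nrm (of_real (d ^ n) \<cdot> (B l ^^ n) x) \<le> e * nrm x"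
proof -
  obtain M where M: "\<And>m x. m \<in> cball l \<rho> - {l0} \<Longrightarrow> nrm (B m x) \<le> M * nrm x"
    using B_compact_bound[OF compact_cball C] by blast
  obtain K where K: "\<And>x. nrm (B l x) \<le> K * nrm x"
    using B_bdd[OF lG] by blast
  define W where "W = {w. cmod w \<le> \<rho> \<and> w \<noteq> of_real d}"
  \<comment> \<open>By \<open>B_identity\<close> between \<open>l - w\<close> and \<open>l\<close>,
    this is the two-sided inverse of \<open>1 - w B l\<close>.\<close>
  define F where "F w x = x + w \<cdot> B (l - w) x" for w x
  have lw: "l - w \<in> cball l \<rho> - {l0}" if "w \<in> W" for w
    using that d(1) by (auto simp: W_def dist_norm algebra_simps)
  then have lwG: "l - w \<in> G" if "w \<in> W" for w
    using that C by blast
  show ?thesis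
  proof (rule power_growth[where S = "B l" and F = F and W = W and d = d])
    show "linop (B l)"
      by (rule B_lin[OF lG])
    show "w \<in> W \<longleftrightarrow> cmod w \<le> \<rho> \<and> w \<noteq> of_real d" for w
      by (simp add: W_def)
    fix w x assume w: "w \<in> W"
    note lin = B_lin[OF lwG[OF w]]
    show "linop (F w)"
      by (rule linopI) (simp_all add: F_def linop_add[OF lin] linop_scale[OF lin] scale_right_distrib mult.commute)
    have "w \<cdot> (B (l - w) x - B l x) = w \<cdot> w \<cdot> B (l - w) (B l x)"
      unfolding B_identity[OF lwG[OF w] lG] by simp
    then show "F w (x - w \<cdot> B l x) = x"
      by (simp add: F_def linop_diff[OF lin] linop_scale[OF lin] scale_right_diff_distrib algebra_simps)
    have "w \<cdot> (B l x - B (l - w) x) = w \<cdot> (- w) \<cdot> B l (B (l - w) x)"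
      unfolding B_identity[OF lG lwG[OF w]] by simp
    then show "F w x - w \<cdot> B l (F w x) = x"
      by (simp add: F_def linop_add[OF B_lin[OF lG]] linop_scale[OF B_lin[OF lG]] scale_right_diff_distrib
          scale_right_distrib algebra_simps)
    have "nrm (F w x) \<le> nrm x + cmod w * nrm (B (l - w) x)"
      using nrm_triangle[of x "w \<cdot> B (l - w) x"] by (simp add: F_def nrm_scale)
    also have "\<dots> \<le> nrm x + \<rho> * (M * nrm x)"
      using w M[OF lw[OF w], of x] d by (intro add_left_mono mult_mono) (auto simp: W_def)
    finally show "nrm (F w x) \<le> (1 + \<rho> * M) * nrm x"
      by (simp add: algebra_simps)
  qed (use d K e in auto)
qed

text \<open>\<open>P\<close> is idempotent and the products of \<open>P\<close> and
  \<open>B l\<close> vanish, so no mixed terms arise. The exponent is a successor because at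
  exponent 0 the formula would force \<open>P x = 0\<close>.\<close>

lemma scaled_R_power:
  assumes l: "l \<in> G"
  shows "((\<lambda>x. (l - l0) \<cdot> R l x) ^^ Suc n) x = P x + (l - l0) ^ Suc n \<cdot> (B l ^^ Suc n) x"
proof (induction n)
  case 0
  then show ?case
    using ne_l0[OF l] by (simp add: B_def scale_right_diff_distrib)
next
  case (Suc n)
  let ?T = "\<lambda>x. (l - l0) \<cdot> R l x" and ?y = "(B l ^^ Suc n) x"
  have T: "?T y = P y + (l - l0) \<cdot> B l y" for y
    using ne_l0[OF l] by (simp add: B_def scale_right_diff_distrib)
  have "(?T ^^ Suc (Suc n)) x = ?T ((?T ^^ Suc n) x)"
    by simp
  also have "\<dots> = ?T (P x + (l - l0) ^ Suc n \<cdot> ?y)"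
    unfolding Suc.IH ..
  also have "\<dots> = P x + (l - l0) ^ Suc n \<cdot> P ?y + (l - l0) ^ Suc (Suc n) \<cdot> B l ?y"
    unfolding T
    by (simp add: linop_add[OF P_lin] linop_scale[OF P_lin] linop_add[OF B_lin[OF l]]
        linop_scale[OF B_lin[OF l]] P_idem B_P[OF l])
  also have "P ?y = 0"
    by (simp add: P_B[OF l])
  finally show ?case
    by simp
qed

end

section \<open>The norm and the cone of a complex Banach lattice\<close>

declare split_paired_All [simp del] split_paired_Ex [simp del]

lemma labs_le_iff: "labs x \<le> u \<longleftrightarrow> x \<le> u \<and> - x \<le> u"
  by (simp add: labs_def)

lemma labs_ge: "x \<le> labs x" "- x \<le> labs x"
  using labs_le_iff[of x "labs x"] by simp_all

lemma labs_nonneg: "0 \<le> labs (x :: 'r::{ordered_real_vector,lattice})"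
proof -
  have "0 \<le> labs x + labs x"
    using add_mono[OF labs_ge[of x]] by simp
  then have "0 \<le> (1/2) *\<^sub>R (labs x + labs x)"
    by (intro scaleR_nonneg_nonneg) auto
  then show ?thesis
    by (simp flip: scaleR_2)
qed

lemma labs_of_nonneg: "0 \<le> x \<Longrightarrow> labs (x :: 'r::{ordered_real_vector,lattice}) = x"
  unfolding labs_def by (rule sup_absorb1) (rule order_trans[of _ 0], simp_all)

lemma labs_triangle: "labs (x + y) \<le> labs x + labs (y :: 'r::{ordered_real_vector,lattice})"
  unfolding labs_le_iff
  using add_mono[OF labs_ge(1)[of x] labs_ge(1)[of y]] add_mono[OF labs_ge(2)[of x] labs_ge(2)[of y]]
  by (simp add: algebra_simps)

lemma labs_scaleR: "labs (c *\<^sub>R x) \<le> \<bar>c\<bar> *\<^sub>R labs (x :: 'r::{ordered_real_vector,lattice})"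
proof (cases "c \<ge> 0")
  case True
  then show ?thesis
    unfolding labs_le_iff using scaleR_left_mono[OF labs_ge(1)] scaleR_left_mono[OF labs_ge(2)] by fastforce
next
  case False
  then have "0 \<le> - c"
    by simp
  from scaleR_left_mono[OF labs_ge(1)[of x] this] scaleR_left_mono[OF labs_ge(2)[of x] this] False
  show ?thesis
    unfolding labs_le_iff by simp
qed

lemma vector_space_csc: "vector_space (csc :: complex \<Rightarrow> 'r::real_vector \<times> 'r \<Rightarrow> 'r \<times> 'r)"
  by standard (simp_all add: csc_def algebra_simps)

text \<open>These are the upper bounds of the modulus. Arguing with all of them lets the norm laws
  be checked without forming the supremum.\<close>

definition modulus_bounds :: "('r::{ordered_real_vector,lattice} \<times> 'r) \<Rightarrow> 'r set" where
  "modulus_bounds z = {u. \<forall>\<theta>::real. labs (cos \<theta> *\<^sub>R fst z + sin \<theta> *\<^sub>R snd z) \<le> u}"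

lemma cnorm_eq: "cnorm z = Inf (norm ` modulus_bounds z)"
  unfolding cnorm_def modulus_bounds_def by (rule arg_cong[where f = Inf]) auto

lemma modulus_boundsD: "u \<in> modulus_bounds z \<Longrightarrow> labs (cos \<theta> *\<^sub>R fst z + sin \<theta> *\<^sub>R snd z) \<le> u"
  by (simp add: modulus_bounds_def)

text \<open>Supplies a member, so that the infimum defining \<open>cnorm\<close> is taken over a
  nonempty set.\<close>

lemma labs_sum_in_modulus_bounds: "labs (fst z) + labs (snd z) \<in> modulus_bounds z"
  unfolding modulus_bounds_def
proof (intro CollectI allI)
  fix \<theta> :: real
  have le1: "\<bar>c\<bar> *\<^sub>R labs w \<le> labs w" if "\<bar>c\<bar> \<le> 1" for c :: real and w :: 'a
    using scaleR_right_mono[OF that labs_nonneg[of w]] by simp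
  have "labs (cos \<theta> *\<^sub>R fst z + sin \<theta> *\<^sub>R snd z) \<le> labs (cos \<theta> *\<^sub>R fst z) + labs (sin \<theta> *\<^sub>R snd z)"
    by (rule labs_triangle)
  also have "\<dots> \<le> \<bar>cos \<theta>\<bar> *\<^sub>R labs (fst z) + \<bar>sin \<theta>\<bar> *\<^sub>R labs (snd z)"
    by (intro add_mono labs_scaleR)
  also have "\<dots> \<le> labs (fst z) + labs (snd z)"
    by (intro add_mono le1) auto
  finally show "labs (cos \<theta> *\<^sub>R fst z + sin \<theta> *\<^sub>R snd z) \<le> labs (fst z) + labs (snd z)" .
qed

lemma modulus_bounds_add:
  assumes "u \<in> modulus_bounds z" "v \<in> modulus_bounds w"
  shows "u + v \<in> modulus_bounds (z + w)"
  unfolding modulus_bounds_def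
proof (intro CollectI allI)
  fix \<theta> :: real
  have "cos \<theta> *\<^sub>R fst (z + w) + sin \<theta> *\<^sub>R snd (z + w)
      = (cos \<theta> *\<^sub>R fst z + sin \<theta> *\<^sub>R snd z) + (cos \<theta> *\<^sub>R fst w + sin \<theta> *\<^sub>R snd w)"
    by (simp add: scaleR_add_right)
  then show "labs (cos \<theta> *\<^sub>R fst (z + w) + sin \<theta> *\<^sub>R snd (z + w)) \<le> u + v"
    using order_trans[OF labs_triangle add_mono[OF modulus_boundsD[OF assms(1)] modulus_boundsD[OF assms(2)]]]
    by metis
qed

text \<open>In polar form, multiplication by \<open>c\<close> shifts the angle by
  \<open>Arg c\<close> and scales by \<open>cmod c\<close>; the family over all angles is invariant
  under the shift.\<close>

lemma modulus_bounds_csc: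
  assumes "u \<in> modulus_bounds z"
  shows "cmod c *\<^sub>R u \<in> modulus_bounds (csc c z)"
  unfolding modulus_bounds_def
proof (intro CollectI allI)
  fix \<theta> :: real
  define \<phi> where "\<phi> = Arg c"
  have c: "Re c = cmod c * cos \<phi>" "Im c = cmod c * sin \<phi>"
    unfolding \<phi>_def by (metis Re_rcis rcis_cmod_Arg, metis Im_rcis rcis_cmod_Arg)
  have "cos \<theta> *\<^sub>R fst (csc c z) + sin \<theta> *\<^sub>R snd (csc c z)
      = cmod c *\<^sub>R (cos (\<theta> - \<phi>) *\<^sub>R fst z + sin (\<theta> - \<phi>) *\<^sub>R snd z)"
    by (simp add: csc_def c cos_diff sin_diff algebra_simps)
  also have "labs \<dots> \<le> \<bar>cmod c\<bar> *\<^sub>R labs (cos (\<theta> - \<phi>) *\<^sub>R fst z + sin (\<theta> - \<phi>) *\<^sub>R snd z)"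
    by (rule labs_scaleR)
  also have "\<dots> \<le> cmod c *\<^sub>R u"
    using scaleR_left_mono[OF modulus_boundsD[OF assms]] by simp
  finally show "labs (cos \<theta> *\<^sub>R fst (csc c z) + sin \<theta> *\<^sub>R snd (csc c z)) \<le> cmod c *\<^sub>R u" .
qed

lemma cnorm_le: "u \<in> modulus_bounds z \<Longrightarrow> cnorm z \<le> norm u"
  unfolding cnorm_eq by (rule cInf_lower) (auto intro: bdd_belowI[of _ 0])

lemma cnorm_approx: "e > 0 \<Longrightarrow> \<exists>u\<in>modulus_bounds z. norm u < cnorm z + e"
  using cInf_lessD[of "norm ` modulus_bounds z" "cnorm z + e"] labs_sum_in_modulus_bounds[of z]
  unfolding cnorm_eq by auto

locale banach_lattice =
  fixes ty :: "'r::{banach,ordered_real_vector,lattice} itself"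
  assumes lattice_norm: "real_banach_lattice ty"
begin

lemma norm_mono: "labs x \<le> u \<Longrightarrow> norm (x :: 'r) \<le> norm u"
  using lattice_norm labs_nonneg[of x] labs_of_nonneg[of u]
  unfolding real_banach_lattice_def by (metis order_trans)

text \<open>The angles 0 and \<open>pi / 2\<close> single out the real and the imaginary
  part.\<close>

lemma norm_components_le_cnorm: "norm (fst z) \<le> cnorm z" "norm (snd z) \<le> cnorm (z :: 'r \<times> 'r)"
proof -
  have "norm (fst z) \<le> norm u" "norm (snd z) \<le> norm u" if "u \<in> modulus_bounds z" for u
    using modulus_boundsD[OF that, of 0] modulus_boundsD[OF that, of "pi / 2"] by (simp_all add: norm_mono)
  then show "norm (fst z) \<le> cnorm z" "norm (snd z) \<le> cnorm z"
    unfolding cnorm_eq using labs_sum_in_modulus_bounds[of z] by (auto intro!: cInf_greatest)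
qed

lemma cnorm_eq_0D: "cnorm z = 0 \<Longrightarrow> z = (0 :: 'r \<times> 'r)"
  using norm_components_le_cnorm[of z] by (simp add: prod_eq_iff)

lemma cnorm_triangle: "cnorm (z + w) \<le> cnorm z + cnorm (w :: 'r \<times> 'r)"
proof (rule field_le_epsilon)
  fix e :: real assume "e > 0"
  then have "e / 2 > 0"
    by simp
  then obtain u v where u: "u \<in> modulus_bounds z" "norm u < cnorm z + e / 2"
    and v: "v \<in> modulus_bounds w" "norm v < cnorm w + e / 2"
    using cnorm_approx by meson
  have "cnorm (z + w) \<le> norm (u + v)"
    by (intro cnorm_le modulus_bounds_add u v)
  also have "\<dots> \<le> norm u + norm v"
    by (rule norm_triangle_ineq)
  finally show "cnorm (z + w) \<le> cnorm z + cnorm w + e"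
    using u v by simp
qed

lemma cnorm_csc_le: "cnorm (csc c z) \<le> cmod c * cnorm (z :: 'r \<times> 'r)"
proof (rule field_le_epsilon)
  fix e :: real assume e: "e > 0"
  have pos: "0 < cmod c + 1"
    by (simp add: add_nonneg_pos)
  obtain u where u: "u \<in> modulus_bounds z" "norm u < cnorm z + e / (cmod c + 1)"
    using cnorm_approx[OF divide_pos_pos[OF e pos]] by blast
  have "cnorm (csc c z) \<le> norm (cmod c *\<^sub>R u)"
    by (intro cnorm_le modulus_bounds_csc u)
  also have "\<dots> \<le> cmod c * (cnorm z + e / (cmod c + 1))"
    using u(2) by (simp add: mult_left_mono)
  also have "\<dots> = cmod c * cnorm z + cmod c / (cmod c + 1) * e"
    by (simp add: distrib_left)
  also have "\<dots> \<le> cmod c * cnorm z + 1 * e"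
    using e pos by (intro add_left_mono mult_right_mono) (auto simp: divide_le_eq_1)
  finally show "cnorm (csc c z) \<le> cmod c * cnorm z + e"
    by simp
qed

text \<open>For \<open>c \<noteq> 0\<close> the reverse inequality is \<open>cnorm_csc_le\<close>
  applied to the factor \<open>1 / c\<close>.\<close>

lemma cnorm_csc: "cnorm (csc c z) = cmod c * cnorm (z :: 'r \<times> 'r)"
proof (cases "c = 0")
  case True
  have "cnorm (csc 0 z) \<le> 0"
    using cnorm_csc_le[of 0 z] by simp
  moreover have "0 \<le> cnorm (csc 0 z)"
    using norm_components_le_cnorm(1) norm_ge_zero order_trans by blast
  ultimately show ?thesis
    using True by simp
next
  case False
  interpret vector_space "csc :: complex \<Rightarrow> 'r \<times> 'r \<Rightarrow> 'r \<times> 'r"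
    by (rule vector_space_csc)
  have "cnorm z = cnorm (csc (1 / c) (csc c z))"
    using False by simp
  also have "\<dots> \<le> cmod (1 / c) * cnorm (csc c z)"
    by (rule cnorm_csc_le)
  finally have "cmod c * cnorm z \<le> cnorm (csc c z)"
    using False by (simp add: norm_divide field_simps)
  with cnorm_csc_le[of c z] show ?thesis
    by simp
qed

sublocale complex_normed_space "csc :: complex \<Rightarrow> 'r \<times> 'r \<Rightarrow> 'r \<times> 'r" cnorm
  unfolding complex_normed_space_def complex_normed_space_axioms_def
  using vector_space_csc cnorm_eq_0D cnorm_triangle cnorm_csc by blast

section \<open>The positive cone and the distance to it\<close>

lemma zero_in_cone: "0 \<in> (pos_cone :: ('r \<times> 'r) set)"
  by (auto simp: pos_cone_def zero_prod_def)

lemma cone_csc: "0 \<le> t \<Longrightarrow> f \<in> pos_cone \<Longrightarrow> csc (of_real t) f \<in> (pos_cone :: ('r \<times> 'r) set)"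
  by (auto simp: pos_cone_def csc_def scaleR_nonneg_nonneg)

lemma dplus_le: "g \<in> pos_cone \<Longrightarrow> dplus f \<le> cnorm (f - g :: 'r \<times> 'r)"
  unfolding dplus_def by (rule cInf_lower) (auto intro!: bdd_belowI[of _ 0])

lemma dplus_nonneg: "0 \<le> dplus (f :: 'r \<times> 'r)"
  unfolding dplus_def using zero_in_cone by (intro cInf_greatest) auto

lemma dplus_approx: "e > 0 \<Longrightarrow> \<exists>g\<in>pos_cone. cnorm (f - g :: 'r \<times> 'r) < dplus f + e"
  using cInf_lessD[of "{cnorm (f - g) | g. g \<in> pos_cone}" "dplus f + e"] zero_in_cone
  unfolding dplus_def by auto

lemma dplus_perturb: "dplus f \<le> dplus h + cnorm (f - h :: 'r \<times> 'r)"
proof (rule field_le_epsilon)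
  fix e :: real assume "e > 0"
  then obtain g where g: "g \<in> pos_cone" "cnorm (h - g) < dplus h + e"
    using dplus_approx by blast
  have "dplus f \<le> cnorm ((f - h) + (h - g))"
    using dplus_le[OF g(1), of f] by simp
  also have "\<dots> \<le> cnorm (f - h) + cnorm (h - g)"
    by (rule nrm_triangle)
  finally show "dplus f \<le> dplus h + cnorm (f - h) + e"
    using g(2) by simp
qed

lemma dplus_csc_le:
  assumes t: "0 < t"
  shows "dplus (csc (of_real t) f) \<le> t * dplus (f :: 'r \<times> 'r)"
proof (rule field_le_epsilon)
  fix e :: real assume "e > 0"
  with t have "e / t > 0"
    by simp
  then obtain g where g: "g \<in> pos_cone" "cnorm (f - g) < dplus f + e / t"
    using dplus_approx by blast
  have "dplus (csc (of_real t) f) \<le> cnorm (csc (of_real t) f - csc (of_real t) g)"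
    using t g by (intro dplus_le cone_csc) auto
  also have "\<dots> = t * cnorm (f - g)"
    using t by (simp add: nrm_scale flip: scale_right_diff_distrib)
  also have "\<dots> \<le> t * (dplus f + e / t)"
    using t g by (intro mult_left_mono) auto
  finally show "dplus (csc (of_real t) f) \<le> t * dplus f + e"
    using t by (simp add: distrib_left)
qed

lemma dplus_csc:
  assumes t: "0 < t"
  shows "dplus (csc (of_real t) f) = t * dplus (f :: 'r \<times> 'r)"
proof (rule antisym)
  have "csc (of_real (1 / t)) (csc (of_real t) f) = f"
    using t by simp
  then have "dplus f \<le> 1 / t * dplus (csc (of_real t) f)"
    using dplus_csc_le[of "1 / t" "csc (of_real t) f"] t by simp
  then show "t * dplus f \<le> dplus (csc (of_real t) f)"
    using t by (simp add: field_simps)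
qed (rule dplus_csc_le[OF t])

text \<open>The cone is closed: for every \<open>g\<close> in it, the negative part of
  \<open>fst f\<close> is dominated by the modulus of \<open>fst (f - g)\<close>, while
  \<open>snd f\<close> equals \<open>snd (f - g)\<close>. Both therefore have arbitrarily small
  norm.\<close>

lemma cone_if_dplus_0:
  assumes "dplus (f :: 'r \<times> 'r) \<le> 0"
  shows "f \<in> pos_cone"
proof -
  have "norm (sup (- fst f) 0) \<le> e \<and> norm (snd f) \<le> e" if "e > 0" for e
  proof -
    obtain g where g: "g \<in> pos_cone" "cnorm (f - g) < dplus f + e"
      using dplus_approx \<open>e > 0\<close> by blast
    then have small: "cnorm (f - g) \<le> e"
      using assms by simp
    from g(1) have g': "0 \<le> fst g" "snd g = 0"
      by (auto simp: pos_cone_def)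
    have "- fst f \<le> fst g - fst f"
      using g' by simp
    also have "\<dots> \<le> labs (fst (f - g))"
      using labs_ge(2)[of "fst (f - g)"] by simp
    finally have "sup (- fst f) 0 \<le> labs (fst (f - g))"
      using labs_nonneg by simp
    then have "labs (sup (- fst f) 0) \<le> labs (fst (f - g))"
      by (subst labs_of_nonneg) auto
    then have "norm (sup (- fst f) 0) \<le> norm (fst (f - g))"
      using lattice_norm unfolding real_banach_lattice_def by blast
    then show ?thesis
      using small norm_components_le_cnorm[of "f - g"] g'(2) by simp
  qed
  then have "norm (sup (- fst f) 0) \<le> 0 + e" "norm (snd f) \<le> 0 + e" if "e > 0" for e
    using that by simp_all
  then have "norm (sup (- fst f) 0) \<le> 0" "norm (snd f) \<le> 0"
    by (blast intro: field_le_epsilon)+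
  then have "sup (- fst f) 0 = 0" "snd f = 0"
    by simp_all
  then have "- fst f \<le> 0"
    by (metis sup_ge1)
  then show ?thesis
    using \<open>snd f = 0\<close> unfolding pos_cone_def by (auto simp: prod_eq_iff)
qed

lemma cbounded_nonneg:
  assumes "cbounded (T :: 'r \<times> 'r \<Rightarrow> 'r \<times> 'r)"
  shows "\<exists>K\<ge>0. \<forall>x. cnorm (T x) \<le> K * cnorm x"
proof -
  obtain K where K: "\<And>x. cnorm (T x) \<le> K * cnorm x"
    using assms unfolding cbounded_def by blast
  have "cnorm (T x) \<le> \<bar>K\<bar> * cnorm x" for x
    by (rule order_trans[OF K]) (rule mult_right_mono, auto)
  then show ?thesis
    by (intro exI[of _ "\<bar>K\<bar>"]) auto
qed

end

section \<open>Resolvents of operators on a Banach lattice\<close>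

lemma resolvent_solves:
  assumes "l \<in> resolvent_set D A"
  shows "resolvent D A l x \<in> D" "csc l (resolvent D A l x) - A (resolvent D A l x) = x"
proof -
  have "\<exists>!y. y \<in> D \<and> csc l y - A y = x"
    using assms by (simp add: resolvent_set_def)
  from theI'[OF this] show "resolvent D A l x \<in> D" "csc l (resolvent D A l x) - A (resolvent D A l x) = x"
    by (auto simp: resolvent_def)
qed

lemma resolvent_eqI:
  assumes "l \<in> resolvent_set D A" "y \<in> D" "csc l y - A y = x"
  shows "resolvent D A l x = y"
proof -
  have "\<exists>!y. y \<in> D \<and> csc l y - A y = x"
    using assms(1) by (simp add: resolvent_set_def)
  then show ?thesis
    using assms resolvent_solves[OF assms(1), of x] by blast
qed

lemma resolvent_setI:
  assumes "\<And>x. Q x \<in> D" "\<And>x. csc l (Q x) - A (Q x) = x"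
    and "\<And>y. y \<in> D \<Longrightarrow> Q (csc l y - A y) = y"
    and "cbounded Q"
  shows "l \<in> resolvent_set D A"
proof -
  have ex1: "\<exists>!y. y \<in> D \<and> csc l y - A y = x" for x
    using assms(1-3) by metis
  moreover have "resolvent D A l = Q"
    using the1_equality[OF ex1] assms(1,2) unfolding resolvent_def by (intro ext) blast
  ultimately show ?thesis
    using assms(4) by (simp add: resolvent_set_def)
qed

locale banach_lattice_operator = banach_lattice ty
  for ty :: "'r::{banach,ordered_real_vector,lattice} itself" +
  fixes D :: "('r \<times> 'r) set" and A :: "'r \<times> 'r \<Rightarrow> 'r \<times> 'r"
  assumes clinear: "clinear_on D A"
begin

lemma D_add: "x \<in> D \<Longrightarrow> y \<in> D \<Longrightarrow> x + y \<in> D" and D_csc: "x \<in> D \<Longrightarrow> csc c x \<in> D"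
  and A_add: "x \<in> D \<Longrightarrow> y \<in> D \<Longrightarrow> A (x + y) = A x + A y"
  and A_csc: "x \<in> D \<Longrightarrow> A (csc c x) = csc c (A x)"
  using clinear by (auto simp: clinear_on_def csubspace_def)

lemma resolvent_linop:
  assumes l: "l \<in> resolvent_set D A"
  shows "linop (resolvent D A l)"
proof (rule linopI)
  note R = resolvent_solves[OF l]
  fix x y c
  show "resolvent D A l (x + y) = resolvent D A l x + resolvent D A l y"
  proof (rule resolvent_eqI[OF l D_add[OF R(1) R(1)]])
    have "csc l (resolvent D A l x + resolvent D A l y) - A (resolvent D A l x + resolvent D A l y)
      = (csc l (resolvent D A l x) - A (resolvent D A l x)) + (csc l (resolvent D A l y) - A (resolvent D A l y))"
      by (simp add: A_add[OF R(1) R(1)] scale_right_distrib)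
    then show "csc l (resolvent D A l x + resolvent D A l y) - A (resolvent D A l x + resolvent D A l y) = x + y"
      by (simp only: R(2))
  qed
  show "resolvent D A l (csc c x) = csc c (resolvent D A l x)"
  proof (rule resolvent_eqI[OF l D_csc[OF R(1)]])
    have "csc l (csc c (resolvent D A l x)) - A (csc c (resolvent D A l x))
      = csc c (csc l (resolvent D A l x) - A (resolvent D A l x))"
      by (simp add: A_csc[OF R(1)] scale_right_diff_distrib mult.commute)
    then show "csc l (csc c (resolvent D A l x)) - A (csc c (resolvent D A l x)) = csc c x"
      by (simp only: R(2))
  qed
qed

lemma resolvent_identity:
  assumes l: "l \<in> resolvent_set D A" and m: "m \<in> resolvent_set D A"
  shows "resolvent D A l x - resolvent D A m x = csc (m - l) (resolvent D A l (resolvent D A m x))"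
proof -
  have "resolvent D A l (x + csc (l - m) (resolvent D A m x)) = resolvent D A m x"
  proof (rule resolvent_eqI[OF l resolvent_solves(1)[OF m]])
    have "csc l (resolvent D A m x) - A (resolvent D A m x)
      = (csc m (resolvent D A m x) - A (resolvent D A m x)) + csc (l - m) (resolvent D A m x)"
      by (simp add: scale_left_diff_distrib)
    then show "csc l (resolvent D A m x) - A (resolvent D A m x) = x + csc (l - m) (resolvent D A m x)"
      by (simp only: resolvent_solves(2)[OF m])
  qed
  then have "resolvent D A m x = resolvent D A l x + csc (l - m) (resolvent D A l (resolvent D A m x))"
    by (simp add: linop_add[OF resolvent_linop[OF l]] linop_scale[OF resolvent_linop[OF l]])
  then have "resolvent D A l x - resolvent D A m x = - csc (l - m) (resolvent D A l (resolvent D A m x))"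
    by (simp add: algebra_simps)
  then show ?thesis
    by (simp flip: scale_minus_left)
qed

text \<open>With \<open>T\<close> the resolvent at \<open>l\<close>, the factorization
  \<open>z - T = z ((l - 1 / z) - A) T\<close> lets each inverse be written in terms of the
  other.\<close>

lemma spectral_mapping_resolvent:
  assumes l: "l \<in> resolvent_set D A" and z: "z \<noteq> 0"
  shows "z \<in> resolvent_set UNIV (resolvent D A l) \<longleftrightarrow> l - 1 / z \<in> resolvent_set D A"
proof
  let ?T = "resolvent D A l"
  note T = resolvent_solves[OF l] and T_lin = resolvent_linop[OF l]
  obtain K where K: "K \<ge> 0" "\<And>x. cnorm (?T x) \<le> K * cnorm x"
    using cbounded_nonneg[of ?T] l unfolding resolvent_set_def by blast
  {
    let ?m = "l - 1 / z"
    assume m: "?m \<in> resolvent_set D A"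
    define S where "S = resolvent D A ?m"
    have S_lin: "linop S"
      unfolding S_def by (rule resolvent_linop[OF m])
    obtain K' where K': "K' \<ge> 0" "\<And>x. cnorm (S x) \<le> K' * cnorm x"
      using cbounded_nonneg[of S] m unfolding resolvent_set_def S_def by blast
    \<comment> \<open>The candidate for the inverse of \<open>z - T\<close>; the two resolvent
      identities between \<open>l\<close> and \<open>l - 1 / z\<close> verify it from either
      side.\<close>
    define Q where "Q x = csc (1 / z) (x + csc (1 / z) (S x))" for x
    have TS: "?T x = S x - csc (1 / z) (?T (S x))" and ST: "S x = ?T x + csc (1 / z) (S (?T x))" for x
      using resolvent_identity[OF l m, of x] resolvent_identity[OF m l, of x]
      by (simp_all add: S_def diff_eq_eq algebra_simps)
    show "z \<in> resolvent_set UNIV ?T"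
    proof (rule resolvent_setI[of Q])
      fix x
      have "csc z (Q x) - ?T (Q x) = x + csc (1 / z) (S x - csc (1 / z) (?T (S x)) - ?T x)"
        using z by (simp add: Q_def linop_add[OF T_lin] linop_scale[OF T_lin] scale_right_distrib
            scale_right_diff_distrib)
      also have "\<dots> = x"
        unfolding TS[of x, symmetric] by simp
      finally show "csc z (Q x) - ?T (Q x) = x" .
      have "Q (csc z x - ?T x) = x + csc (1 / z) (S x - (?T x + csc (1 / z) (S (?T x))))"
        using z by (simp add: Q_def linop_diff[OF S_lin] linop_scale[OF S_lin] scale_right_distrib
            scale_right_diff_distrib)
      also have "\<dots> = x"
        unfolding ST[of x, symmetric] by simp
      finally show "Q (csc z x - ?T x) = x" .
    next
      have "cnorm (Q x) \<le> (cmod (1 / z) * (1 + cmod (1 / z) * K')) * cnorm x" for x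
      proof -
        have "cnorm (x + csc (1 / z) (S x)) \<le> cnorm x + cmod (1 / z) * cnorm (S x)"
          using nrm_triangle[of x "csc (1 / z) (S x)"] by (simp only: nrm_scale)
        also have "\<dots> \<le> cnorm x + cmod (1 / z) * (K' * cnorm x)"
          using K' by (intro add_left_mono mult_left_mono) auto
        finally have "cmod (1 / z) * cnorm (x + csc (1 / z) (S x))
            \<le> cmod (1 / z) * (cnorm x + cmod (1 / z) * (K' * cnorm x))"
          by (rule mult_left_mono) simp
        then show ?thesis
          unfolding Q_def nrm_scale[of "1 / z" "x + csc (1 / z) (S x)"] by (simp add: algebra_simps)
      qed
      then show "cbounded Q"
        unfolding cbounded_def by blast
    qed simp
  }
  {
    assume zr: "z \<in> resolvent_set UNIV ?T"
    define V where "V = resolvent UNIV ?T z"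
    have V: "csc z (V x) - ?T (V x) = x" for x
      unfolding V_def by (rule resolvent_solves(2)[OF zr])
    obtain K' where K': "K' \<ge> 0" "\<And>x. cnorm (V x) \<le> K' * cnorm x"
      using cbounded_nonneg[of V] zr unfolding resolvent_set_def V_def by blast
    show "l - 1 / z \<in> resolvent_set D A"
    proof (rule resolvent_setI[of "\<lambda>x. V (csc z (?T x))"])
      fix x
      let ?y = "V (csc z (?T x))"
      have "csc z ?y = ?T ?y + csc z (?T x)"
        using V[of "csc z (?T x)"] by (simp add: diff_eq_eq add.commute)
      then have "csc (1 / z) (csc z ?y) = csc (1 / z) (?T ?y + csc z (?T x))"
        by simp
      \<comment> \<open>Solving the equation for \<open>?y\<close> exhibits it as a value of
        \<open>?T\<close>, which places it in \<open>D\<close> and makes \<open>A ?y\<close>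
        computable.\<close>
      then have y: "?y = ?T (csc (1 / z) ?y + x)"
        using z by (simp add: linop_add[OF T_lin] linop_scale[OF T_lin] scale_right_distrib)
      show "?y \<in> D"
        by (subst y) (rule T(1))
      have "csc l ?y - A ?y = csc (1 / z) ?y + x"
        using T(2)[of "csc (1 / z) ?y + x"] unfolding y[symmetric] .
      then show "csc (l - 1 / z) ?y - A ?y = x"
        by (simp add: scale_left_diff_distrib algebra_simps)
    next
      fix y assume y: "y \<in> D"
      define x where "x = csc (l - 1 / z) y - A y"
      have "?T (x + csc (1 / z) y) = y"
        by (rule resolvent_eqI[OF l y]) (simp add: x_def scale_left_diff_distrib)
      then have "csc z (?T x + csc (1 / z) (?T y)) = csc z y"
        by (simp add: linop_add[OF T_lin] linop_scale[OF T_lin])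
      then have "csc z y - ?T y = csc z (?T x)"
        using z by (simp add: scale_right_distrib algebra_simps)
      then show "V (csc z (?T (csc (l - 1 / z) y - A y))) = y"
        unfolding V_def x_def[symmetric] by (intro resolvent_eqI[OF zr]) auto
    next
      have "cnorm (V (csc z (?T x))) \<le> (K' * (cmod z * K)) * cnorm x" for x
      proof -
        have "cnorm (V (csc z (?T x))) \<le> K' * (cmod z * cnorm (?T x))"
          using K'(2)[of "csc z (?T x)"] by (simp only: nrm_scale)
        also have "\<dots> \<le> K' * (cmod z * (K * cnorm x))"
          using K K' by (intro mult_left_mono) auto
        finally show ?thesis
          by (simp add: mult.assoc)
      qed
      then show "cbounded (\<lambda>x. V (csc z (?T x)))"
        unfolding cbounded_def by blast
    qed
  }
qed

section \<open>Spectral bound and spectral radius\<close>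

lemma spectrum_Re_le:
  assumes "spectral_bound D A = ereal s" "m \<in> spectrum D A"
  shows "Re m \<le> s"
proof -
  have "ereal (Re m) \<le> spectral_bound D A"
    unfolding spectral_bound_def using assms(2) by (intro Sup_upper) auto
  then show ?thesis
    using assms(1) by simp
qed

lemma in_resolvent_set_if_Re_gt:
  assumes "spectral_bound D A = ereal s" "s < Re m"
  shows "m \<in> resolvent_set D A"
  using spectrum_Re_le[OF assms(1), of m] assms(2) by (auto simp: spectrum_def)

text \<open>The map sending \<open>m\<close> to \<open>1 / (l - m)\<close> takes the half plane
  \<open>Re m \<le> s\<close> into the disc of radius \<open>1 / (l - s)\<close>, and the spectral
  value \<open>s\<close> is sent to its boundary. The point \<open>z = 0\<close> lies outside the
  spectral mapping and is treated separately.\<close>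

lemma spectral_radius_resolvent:
  assumes sb: "spectral_bound D A = ereal s" and s: "complex_of_real s \<in> spectrum D A" and l: "s < l"
  shows "spectral_radius (resolvent D A (of_real l)) = 1 / (l - s)"
  unfolding spectral_radius_def
proof (rule cSup_eq_maximum)
  let ?T = "resolvent D A (complex_of_real l)"
  have lr: "complex_of_real l \<in> resolvent_set D A"
    by (rule in_resolvent_set_if_Re_gt[OF sb]) (simp add: l)
  have "complex_of_real (1 / (l - s)) \<in> spectrum UNIV ?T"
    using spectral_mapping_resolvent[OF lr, of "of_real (1 / (l - s))"] s l by (simp add: spectrum_def)
  moreover have "cmod (complex_of_real (1 / (l - s))) = 1 / (l - s)"
    using l by (subst norm_of_real) simp
  ultimately show "1 / (l - s) \<in> cmod ` spectrum UNIV ?T"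
    by (metis image_eqI)
  fix x assume "x \<in> cmod ` spectrum UNIV ?T"
  then obtain z where z: "z \<in> spectrum UNIV ?T" "x = cmod z"
    by blast
  show "x \<le> 1 / (l - s)"
  proof (cases "z = 0")
    case False
    then have "of_real l - 1 / z \<in> spectrum D A"
      using spectral_mapping_resolvent[OF lr False] z(1) by (simp add: spectrum_def)
    from spectrum_Re_le[OF sb this] have "l - s \<le> Re (1 / z)"
      by simp
    also have "\<dots> \<le> cmod (1 / z)"
      by (rule complex_Re_le_cmod)
    finally have "l - s \<le> 1 / cmod z"
      by (simp add: norm_divide)
    then show ?thesis
      using z(2) l False by (simp add: field_simps)
  qed (use z l in simp)
qed

end

section \<open>Asymptotic positivity\<close>

text \<open>Transfers limits over complex punctured neighbourhoods to the one-sided real limits in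
  the positivity notions.\<close>

lemma filterlim_of_real_at_right: "filterlim complex_of_real (at (of_real a)) (at_right a)"
  unfolding filterlim_at
  by (auto intro!: tendsto_intros simp: eventually_at_filter)

locale lattice_operator_pole =
  banach_lattice_operator ty D A +
  simple_pole_resolvent csc cnorm "resolvent_set D A" "resolvent D A" "complex_of_real l0" P r
  for ty :: "'r::{banach,ordered_real_vector,lattice} itself" and D A and l0 r :: real and P
begin

text \<open>Both positivity notions for the resolvent include this condition. Near the pole the
  scaled resolvent is within distance 1 of the bounded operator \<open>P\<close>, which gives the
  constant \<open>K + 1\<close>.\<close>

lemma admissible: "resolvent_admissible D A l0"
  unfolding resolvent_admissible_def
proof (intro conjI)
  show "\<exists>e>0. \<forall>l\<in>{l0<..l0 + e}. complex_of_real l \<in> resolvent_set D A"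
    using r by (intro exI[of _ "r / 2"]) (auto simp: dist_norm norm_minus_commute simp flip: of_real_diff)
  obtain K where K: "\<And>x. cnorm (P x) \<le> K * cnorm x"
    using P_bdd by blast
  have "\<forall>\<^sub>F l in at_right l0. \<forall>x.
      cnorm (csc (complex_of_real l - of_real l0) (resolvent D A (of_real l) x) - P x) \<le> 1 * cnorm x"
    by (rule eventually_compose_filterlim[OF P_lim filterlim_of_real_at_right]) simp
  then have "\<forall>\<^sub>F l in at_right l0. \<forall>x.
      cnorm (csc (complex_of_real (l - l0)) (resolvent D A (of_real l) x)) \<le> (K + 1) * cnorm x"
  proof (rule eventually_mono, intro allI)
    fix l x
    let ?y = "csc (complex_of_real l - of_real l0) (resolvent D A (of_real l) x)"
    assume "\<forall>x. cnorm (csc (complex_of_real l - of_real l0) (resolvent D A (of_real l) x) - P x) \<le> 1 * cnorm x"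
    then have "cnorm (?y - P x) \<le> cnorm x"
      by simp
    then show "cnorm (csc (complex_of_real (l - l0)) (resolvent D A (of_real l) x)) \<le> (K + 1) * cnorm x"
      using nrm_triangle[of "?y - P x" "P x"] K[of x] by (simp add: distrib_right)
  qed
  then show "\<exists>M. \<forall>\<^sub>F l in at_right l0. \<forall>x.
      cnorm (csc (complex_of_real (l - l0)) (resolvent D A (of_real l) x)) \<le> M * cnorm x"
    by blast
qed

text \<open>The principal part \<open>P f / (l - l0)\<close> lies in the cone and misses the
  resolvent by exactly \<open>B l f\<close>, which is bounded near the pole.\<close>

lemma positive_imp_uniform:
  assumes "positive_op P"
  shows "res_unif_asym_pos_bdd D A l0"
proof -
  obtain e K where e: "e > 0" and K: "K \<ge> 0"
    and near: "\<And>m. m \<noteq> of_real l0 \<Longrightarrow> dist m (of_real l0) < e \<Longrightarrow>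
      m \<in> resolvent_set D A \<and> (\<forall>x. cnorm (B m x) \<le> K * cnorm x)"
    using B_near_pole by blast
  have l: "complex_of_real l \<noteq> of_real l0" "dist (complex_of_real l) (of_real l0) < e"
    if "l \<in> {l0<..l0 + e / 2}" for l
    using that e by (auto simp: dist_norm simp flip: of_real_diff)
  have "dplus (resolvent D A (of_real l) f) \<le> K * cnorm f"
    if f: "f \<in> pos_cone" and lr: "l \<in> {l0<..l0 + e / 2}" for f l
  proof -
    let ?h = "csc (of_real (1 / (l - l0))) (P f)"
    have "?h \<in> pos_cone"
      using assms f lr by (intro cone_csc) (auto simp: positive_op_def)
    then have "dplus (resolvent D A (of_real l) f) \<le> cnorm (resolvent D A (of_real l) f - ?h)"
      by (rule dplus_le)
    also have "\<dots> = cnorm (B (of_real l) f)"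
      by (simp add: B_def)
    also have "\<dots> \<le> K * cnorm f"
      using near[OF l[OF lr]] by blast
    finally show ?thesis .
  qed
  then show ?thesis
    unfolding res_unif_asym_pos_bdd_def using admissible K e near l
    by (intro conjI exI[of _ "l0 + e / 2"] exI[of _ K]) auto
qed

lemma uniform_imp_individual:
  assumes "res_unif_asym_pos_bdd D A l0"
  shows "res_indiv_asym_pos D A l0"
proof -
  obtain l1 K where l1: "l1 > l0"
    and bound: "\<And>f l. f \<in> pos_cone \<Longrightarrow> l \<in> {l0<..l1} \<Longrightarrow> dplus (resolvent D A (of_real l) f) \<le> K * cnorm f"
    using assms unfolding res_unif_asym_pos_bdd_def by blast
  have "((\<lambda>l. (l - l0) * dplus (resolvent D A (of_real l) f)) \<longlongrightarrow> 0) (at_right l0)"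
    if f: "f \<in> pos_cone" for f
  proof (rule tendsto_sandwich[OF _ _ tendsto_const])
    have ev: "\<forall>\<^sub>F l in at_right l0. l \<in> {l0<..l1}"
      by (rule eventually_at_rightI[OF _ l1]) auto
    show "\<forall>\<^sub>F l in at_right l0. 0 \<le> (l - l0) * dplus (resolvent D A (of_real l) f)"
      using ev by (rule eventually_mono) (auto simp: dplus_nonneg)
    show "\<forall>\<^sub>F l in at_right l0. (l - l0) * dplus (resolvent D A (of_real l) f) \<le> (l - l0) * (K * cnorm f)"
      using ev by (rule eventually_mono) (auto intro!: mult_left_mono bound f)
    have "((\<lambda>l. (l - l0) * (K * cnorm f)) \<longlongrightarrow> (l0 - l0) * (K * cnorm f)) (at_right l0)"
      by (intro tendsto_intros)
    then show "((\<lambda>l. (l - l0) * (K * cnorm f)) \<longlongrightarrow> 0) (at_right l0)"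
      by simp
  qed
  then show ?thesis
    using admissible unfolding res_indiv_asym_pos_def by blast
qed

lemma individual_imp_positive:
  assumes "res_indiv_asym_pos D A l0"
  shows "positive_op P"
  unfolding positive_op_def
proof (intro ballI cone_if_dplus_0)
  fix f :: "'r \<times> 'r" assume f: "f \<in> pos_cone"
  let ?g = "\<lambda>l. csc (complex_of_real l - of_real l0) (resolvent D A (of_real l) f)"
  have "((\<lambda>l. cnorm (?g l - P f)) \<longlongrightarrow> 0) (at_right l0)"
    using filterlim_compose[OF P_conv[of f, unfolded conv_def] filterlim_of_real_at_right] .
  moreover have "((\<lambda>l. (l - l0) * dplus (resolvent D A (of_real l) f)) \<longlongrightarrow> 0) (at_right l0)"
    using assms f unfolding res_indiv_asym_pos_def by blast
  ultimately have lim: "((\<lambda>l. (l - l0) * dplus (resolvent D A (of_real l) f) + cnorm (?g l - P f)) \<longlongrightarrow> 0) (at_right l0)"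
    by (rule tendsto_add_zero[rotated])
  have "\<forall>\<^sub>F l in at_right l0. dplus (P f) \<le> (l - l0) * dplus (resolvent D A (of_real l) f) + cnorm (?g l - P f)"
    using eventually_at_right_less
  proof (rule eventually_mono)
    fix l assume "l0 < l"
    then have "dplus (?g l) = (l - l0) * dplus (resolvent D A (of_real l) f)"
      using dplus_csc[of "l - l0"] by simp
    then show "dplus (P f) \<le> (l - l0) * dplus (resolvent D A (of_real l) f) + cnorm (?g l - P f)"
      using dplus_perturb[of "P f" "?g l"] nrm_minus_commute[of "P f" "?g l"] by simp
  qed
  then show "dplus (P f) \<le> 0"
    by (rule tendsto_lowerbound[OF lim]) simp
qed

section \<open>Powers of the resolvent to the right of the spectral bound\<close>

context
  fixes l :: real
  assumes sb: "spectral_bound D A = ereal l0" and l: "l0 < l"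
begin

abbreviation N where "N \<equiv> normalized_op (resolvent D A (complex_of_real l))"

lemma l_in_resolvent_set: "complex_of_real l \<in> resolvent_set D A"
  by (rule in_resolvent_set_if_Re_gt[OF sb]) (simp add: l)

lemma radius: "spectral_radius (resolvent D A (complex_of_real l)) = 1 / (l - l0)"
  using spectral_radius_resolvent[OF sb _ l] l0_notin by (simp add: spectrum_def)

lemma N_eq: "N = (\<lambda>x. csc (complex_of_real l - of_real l0) (resolvent D A (of_real l) x))"
  unfolding normalized_op_def radius by simp

lemma N_powers_tendsto_P:
  assumes e: "0 < e"
  shows "\<exists>n0. \<forall>n\<ge>n0. \<forall>x. cnorm ((N ^^ n) x - P x) \<le> e * cnorm x"
proof -
  define d where "d = l - l0"
  have d: "0 < d"
    using l by (simp add: d_def)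
  have "sqrt (d\<^sup>2) < sqrt (d\<^sup>2 + r\<^sup>2)"
    using r by (intro real_sqrt_less_mono) auto
  then have "d < sqrt (d\<^sup>2 + r\<^sup>2)"
    using d by simp
  \<comment> \<open>The square root bounds from below the distance from \<open>l\<close> to the
    spectrum without \<open>l0\<close>; any radius strictly between \<open>d\<close> and it gives a
    disc that meets the spectrum only in \<open>l0\<close>.\<close>
  then obtain \<rho> where \<rho>: "d < \<rho>" "\<rho> < sqrt (d\<^sup>2 + r\<^sup>2)"
    using dense by blast
  have "cball (of_real l) \<rho> - {complex_of_real l0} \<subseteq> resolvent_set D A"
  proof (rule ccontr)
    assume "\<not> ?thesis"
    then obtain m where "m \<in> cball (of_real l) \<rho>" "m \<noteq> of_real l0" "m \<notin> resolvent_set D A"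
      by blast
    then have m: "cmod (m - of_real l) \<le> \<rho>" "m \<noteq> of_real l0" "m \<in> spectrum D A"
      by (simp_all add: spectrum_def dist_norm norm_minus_commute)
    have Re: "Re m \<le> l0"
      by (rule spectrum_Re_le[OF sb m(3)])
    have "m \<notin> ball (of_real l0) r"
      using m r(2) by (auto simp: spectrum_def)
    then have "r \<le> cmod (m - of_real l0)"
      by (simp add: dist_norm norm_minus_commute)
    then have "r\<^sup>2 \<le> (cmod (m - of_real l0))\<^sup>2"
      using r by (intro power_mono) auto
    then have r2: "r\<^sup>2 \<le> (Re m - l0)\<^sup>2 + (Im m)\<^sup>2"
      by (simp add: cmod_power2)
    have "0 \<le> (l0 - Re m) * d"
      using Re d by (intro mult_nonneg_nonneg) auto
    \<comment> \<open>Because \<open>Re m \<le> l0 < l\<close>, the cross term is nonnegative and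
      may be dropped.\<close>
    moreover have "(Re m - l)\<^sup>2 = d\<^sup>2 + (Re m - l0)\<^sup>2 + 2 * ((l0 - Re m) * d)"
      by (simp add: d_def power2_eq_square algebra_simps)
    ultimately have "d\<^sup>2 + r\<^sup>2 \<le> (Re m - l)\<^sup>2 + (Im m)\<^sup>2"
      using r2 by simp
    also have "\<dots> = (cmod (m - of_real l))\<^sup>2"
      by (simp add: cmod_power2)
    also have "\<dots> \<le> \<rho>\<^sup>2"
      using m by (intro power_mono) auto
    finally have "sqrt (d\<^sup>2 + r\<^sup>2) \<le> \<rho>"
      using \<rho> d by (intro real_le_lsqrt) auto
    with \<rho> show False
      by simp
  qed
  then obtain n0 where n0: "\<And>n x. n \<ge> n0 \<Longrightarrow> cnorm (csc (of_real (d ^ n)) ((B (of_real l) ^^ n) x)) \<le> e * cnorm x"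
    using B_powers_tendsto_0[OF l_in_resolvent_set _ d \<rho>(1) _ e] by (auto simp: d_def)
  have "cnorm ((N ^^ n) x - P x) \<le> e * cnorm x" if n: "n \<ge> Suc n0" for n x
  proof -
    obtain k where k: "n = Suc k"
      using n by (cases n) auto
    have "(N ^^ n) x = P x + csc ((complex_of_real l - of_real l0) ^ n) ((B (of_real l) ^^ n) x)"
      unfolding N_eq k by (rule scaled_R_power[OF l_in_resolvent_set])
    then have "(N ^^ n) x - P x = csc (of_real (d ^ n)) ((B (of_real l) ^^ n) x)"
      by (simp add: d_def)
    then show ?thesis
      using n0[of n x] n by simp
  qed
  then show ?thesis
    by blast
qed

text \<open>From some exponent \<open>n0\<close> on the powers are within 1 of \<open>P\<close>; the
  finitely many earlier ones are controlled by \<open>C ^ n0\<close>, where \<open>C \<ge> 1\<close>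
  makes \<open>C ^ n\<close> increasing in \<open>n\<close>.\<close>

lemma N_power_bounded: "power_bounded N"
proof -
  obtain n0 where n0: "\<And>n x. n \<ge> n0 \<Longrightarrow> cnorm ((N ^^ n) x - P x) \<le> 1 * cnorm x"
    using N_powers_tendsto_P[of 1] by auto
  obtain K where K: "\<And>x. cnorm (P x) \<le> K * cnorm x"
    using P_bdd by blast
  obtain K' where K': "K' \<ge> 0" "\<And>x. cnorm (resolvent D A (of_real l) x) \<le> K' * cnorm x"
    using cbounded_nonneg l_in_resolvent_set unfolding resolvent_set_def by blast
  define C where "C = 1 + (l - l0) * K'"
  have C: "1 \<le> C"
    using l K' by (simp add: C_def)
  have step: "cnorm (N x) \<le> C * cnorm x" for x
  proof -
    have "cnorm (N x) = (l - l0) * cnorm (resolvent D A (of_real l) x)"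
      using l by (simp add: N_eq nrm_scale flip: of_real_diff)
    also have "\<dots> \<le> (l - l0) * (K' * cnorm x)"
      using l K' by (intro mult_left_mono) auto
    also have "\<dots> \<le> C * cnorm x"
      by (simp add: C_def algebra_simps)
    finally show ?thesis .
  qed
  have pow: "cnorm ((N ^^ n) x) \<le> C ^ n * cnorm x" for n x
  proof (induction n)
    case (Suc n)
    have "cnorm ((N ^^ Suc n) x) \<le> C * cnorm ((N ^^ n) x)"
      using step by simp
    also have "\<dots> \<le> C * (C ^ n * cnorm x)"
      using Suc.IH C by (intro mult_left_mono) auto
    finally show ?case
      by (simp add: mult.assoc)
  qed simp
  have "cnorm ((N ^^ n) x) \<le> max (C ^ n0) (K + 1) * cnorm x" for n x
  proof (cases "n \<ge> n0")
    case True
    have "cnorm ((N ^^ n) x) \<le> (K + 1) * cnorm x"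
      using nrm_triangle[of "(N ^^ n) x - P x" "P x"] n0[OF True, of x] K[of x] by (simp add: distrib_right)
    also have "\<dots> \<le> max (C ^ n0) (K + 1) * cnorm x"
      by (intro mult_right_mono) auto
    finally show ?thesis .
  next
    case False
    then have "C ^ n \<le> max (C ^ n0) (K + 1)"
      using power_increasing[of n n0 C] C by simp
    then show ?thesis
      using order_trans[OF pow mult_right_mono[OF _ nrm_nonneg]] by blast
  qed
  then show ?thesis
    unfolding power_bounded_def by blast
qed

lemma positive_imp_uniform_powers:
  assumes "positive_op P"
  shows "op_unif_asym_pos (resolvent D A (complex_of_real l))"
  unfolding op_unif_asym_pos_def radius
proof (intro conjI allI impI)
  show "0 < 1 / (l - l0)"
    using l by simp
  show "power_bounded N"
    by (rule N_power_bounded)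
  fix e :: real assume "e > 0"
  then obtain n0 where n0: "\<And>n x. n \<ge> n0 \<Longrightarrow> cnorm ((N ^^ n) x - P x) \<le> e * cnorm x"
    using N_powers_tendsto_P by blast
  have "dplus ((N ^^ n) f) \<le> e * cnorm f" if "n \<ge> n0" "f \<in> pos_cone" for n f
    using dplus_le[of "P f" "(N ^^ n) f"] n0[OF that(1), of f] assms that(2) by (simp add: positive_op_def)
  then show "\<exists>n0. \<forall>n\<ge>n0. \<forall>f\<in>pos_cone. dplus ((N ^^ n) f) \<le> e * cnorm f"
    by blast
qed

lemma individual_powers_imp_positive:
  assumes "op_indiv_asym_pos (resolvent D A (complex_of_real l))"
  shows "positive_op P"
  unfolding positive_op_def
proof (intro ballI cone_if_dplus_0)
  fix f :: "'r \<times> 'r" assume f: "f \<in> pos_cone"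
  have "conv (\<lambda>n. (N ^^ n) f) (P f) sequentially"
  proof (rule conv_if_uniform)
    fix e :: real assume "e > 0"
    from N_powers_tendsto_P[OF this]
    show "\<forall>\<^sub>F n in sequentially. cnorm ((N ^^ n) f - P f) \<le> e * cnorm f"
      unfolding eventually_sequentially by blast
  qed
  then have "(\<lambda>n. cnorm ((N ^^ n) f - P f)) \<longlonglongrightarrow> 0"
    by (simp add: conv_def)
  moreover have "(\<lambda>n. dplus ((N ^^ n) f)) \<longlonglongrightarrow> 0"
    using assms f unfolding op_indiv_asym_pos_def by blast
  ultimately have lim: "(\<lambda>n. dplus ((N ^^ n) f) + cnorm ((N ^^ n) f - P f)) \<longlonglongrightarrow> 0"
    by (rule tendsto_add_zero[rotated])
  have "dplus (P f) \<le> dplus ((N ^^ n) f) + cnorm ((N ^^ n) f - P f)" for n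
    using dplus_perturb[of "P f" "(N ^^ n) f"] nrm_minus_commute[of "P f" "(N ^^ n) f"] by simp
  then show "dplus (P f) \<le> 0"
    by (intro tendsto_lowerbound[OF lim]) auto
qed

end

end

lemma (in banach_lattice) uniform_powers_imp_individual:
  assumes "op_unif_asym_pos (T :: 'r \<times> 'r \<Rightarrow> 'r \<times> 'r)"
  shows "op_indiv_asym_pos T"
proof -
  have "(\<lambda>n. dplus ((normalized_op T ^^ n) f)) \<longlonglongrightarrow> 0" if f: "f \<in> pos_cone" for f
  proof (rule LIMSEQ_I)
    fix e :: real assume e: "e > 0"
    \<comment> \<open>Adding 1 covers \<open>f = 0\<close> and makes the resulting inequality
      strict.\<close>
    have pos: "0 < cnorm f + 1"
      by (simp add: add_nonneg_pos)
    obtain n0 where n0: "\<And>n. n \<ge> n0 \<Longrightarrow> dplus ((normalized_op T ^^ n) f) \<le> e / (cnorm f + 1) * cnorm f"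
      using assms f divide_pos_pos[OF e pos] unfolding op_unif_asym_pos_def by meson
    have "e / (cnorm f + 1) * cnorm f < e"
      using e pos by (simp add: pos_divide_less_eq)
    then show "\<exists>n0. \<forall>n\<ge>n0. norm (dplus ((normalized_op T ^^ n) f) - 0) < e"
      using n0 dplus_nonneg by (intro exI[of _ n0]) (auto intro: le_less_trans)
  qed
  then show ?thesis
    using assms unfolding op_unif_asym_pos_def op_indiv_asym_pos_def by blast
qed

theorem theorem7p6:
  fixes D :: "('r::{banach,ordered_real_vector,lattice} \<times> 'r) set"
    and A :: "'r \<times> 'r \<Rightarrow> 'r \<times> 'r"
    and l0 :: real
  assumes "real_banach_lattice TYPE('r)"
    and "closed_operator D A"
    and "complex_of_real l0 \<in> spectrum D A"
    and "simple_pole D A (complex_of_real l0)"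
  shows "(positive_op (residue_op D A (complex_of_real l0)) \<longleftrightarrow> res_indiv_asym_pos D A l0)
       \<and> (res_indiv_asym_pos D A l0 \<longleftrightarrow> res_unif_asym_pos_bdd D A l0)
       \<and> (spectral_bound D A = ereal l0 \<longrightarrow>
            (positive_op (residue_op D A (complex_of_real l0)) \<longleftrightarrow>
               (\<exists>l. ereal l > spectral_bound D A \<and>
                   op_indiv_asym_pos (resolvent D A (complex_of_real l))))
          \<and> (positive_op (residue_op D A (complex_of_real l0)) \<longleftrightarrow>
               (\<forall>l. ereal l > spectral_bound D A \<longrightarrow>
                   op_unif_asym_pos (resolvent D A (complex_of_real l)))))"
proof -
  interpret banach_lattice_operator "TYPE('r)" D A
    by standard (use assms(1,2) in \<open>simp_all add: closed_operator_def\<close>)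
  obtain r P where r: "r > 0" "ball (complex_of_real l0) r - {of_real l0} \<subseteq> resolvent_set D A"
    and P: "cbounded P" "residue_limit D A (of_real l0) P"
    using assms(4) unfolding simple_pole_def by blast
  interpret lattice_operator_pole "TYPE('r)" D A l0 r P
  proof unfold_locales
    show "resolvent D A l (x + y) = resolvent D A l x + resolvent D A l y"
      if "l \<in> resolvent_set D A" for l x y
      by (rule linop_add[OF resolvent_linop[OF that]])
    show "resolvent D A l (csc c x) = csc c (resolvent D A l x)" if "l \<in> resolvent_set D A" for l c x
      by (rule linop_scale[OF resolvent_linop[OF that]])
    show "\<exists>K. \<forall>x. cnorm (resolvent D A l x) \<le> K * cnorm x" if "l \<in> resolvent_set D A" for l
      using that by (simp add: resolvent_set_def cbounded_def)
    show "complex_of_real l0 \<notin> resolvent_set D A"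
      using assms(3) by (simp add: spectrum_def)
  qed (use r P resolvent_identity in \<open>auto simp: cbounded_def residue_limit_def\<close>)
  have residue: "residue_op D A (complex_of_real l0) = P"
    unfolding residue_op_def
  proof (rule the_equality)
    show "Q = P" if "residue_limit D A (complex_of_real l0) Q" for Q
      using that by (intro P_unique) (simp add: residue_limit_def)
  qed (rule P(2))
  have "positive_op P \<longleftrightarrow> res_indiv_asym_pos D A l0"
    and "res_indiv_asym_pos D A l0 \<longleftrightarrow> res_unif_asym_pos_bdd D A l0"
    using positive_imp_uniform uniform_imp_individual individual_imp_positive by blast+
  \<comment> \<open>Positivity gives uniform decay for every \<open>l > l0\<close>; as such an
    \<open>l\<close> exists, individual decay follows for one of them, and this returns
    positivity.\<close>
  moreover have "(positive_op P \<longleftrightarrow> (\<exists>l>l0. op_indiv_asym_pos (resolvent D A (complex_of_real l))))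
      \<and> (positive_op P \<longleftrightarrow> (\<forall>l>l0. op_unif_asym_pos (resolvent D A (complex_of_real l))))"
    if sb: "spectral_bound D A = ereal l0"
    using positive_imp_uniform_powers[OF sb] individual_powers_imp_positive[OF sb]
      uniform_powers_imp_individual gt_ex by meson
  ultimately show ?thesis
    unfolding residue by auto
qed

end
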